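(* Let $G$ and $H$ be rooted labeled graphs with roots labeled $i$ and $j$ respectively. For a rooted graph $K$ let $K^*$ denote $K$ with one added isolated vertex, rooted at the root of $K$. If $G^*$ is stem-symmetric at its root labeled $i$ and $H^*$ is stem-symmetric at its root labeled $j$ with a root-similar vertex, then $(G*H)^*$ is stem-symmetric at the vertex labeled $(j,i)$, where $G*H$ is the comb product.
   Context: All graphs are finite and simple. A labeled graph $G$ comes with a bijection $\lambda:V(G)\to X$ onto a label set $X$; write $v_x=\lambda^{-1}(x)$ and $L_G=\{ij: v_iv_j\in E(G)\}$ (unordered pairs). For $\sigma\in\operatorname{Sym}(X)$, $G_\sigma$ is the graph on $V(G)$ with edge set $\{v_iv_j:\sigma(i)\sigma(j)\in L_G\}$. $\operatorname{Aut}(G)$ is identified with $\{\sigma\in\operatorname{Sym}(X): G_\sigma=G\}$. An edge-replacement $rs\to kl$ removes an edge $v_rv_s\in E(G)$ and adds $v_kv_l\in E(\overline G)\cup\{v_rv_s\}$; it is feasible if $G-v_rv_s+v_kv_l\cong G$. $R_G$ is the set of feasible edge-replacements $rs\to kl$ with $rs\ne kl$ together with the neutral replacement $\emptyset\to\emptyset$ (nothing changes). $\operatorname{Fer}_G(rs\to kl)=\{\sigma\in\operatorname{Sym}(X): G_\sigma=G-v_rv_s+v_kv_l\}$ and $\operatorname{Fer}_G(\emptyset\to\emptyset)=\operatorname{Aut}(G)$. $\mathcal{E}_G$ is the union of the sets $\operatorname{Fer}_G(e\to e')$ over all $e\to e'\in R_G$. For $i\in X$, $\mathcal{E}_G^i=\{\sigma\in\mathcal{E}_G:\sigma(i)=i\}$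 and $\operatorname{Fer}^i(G)=\langle\mathcal{E}_G^i\rangle\le\operatorname{Sym}(X)$. $G$ is stem-symmetric at the vertex $v_i$ (or at the label $i$) if $\operatorname{Fer}^i(G)\cong S_{|V(G)|-1}$. A root-similar vertex of a graph with root labeled $k$ is a vertex $v_l$, $l\neq k$, such that some automorphism $\varphi$ satisfies $\varphi(k)=l$. Comb product: for a graph $G$ and a graph $H$ with root $v$, $G*H$ has vertex set $V(G)\times V(H)$, with an edge between $(u,v)$ and $(u',v)$ for each $uu'\in E(G)$, and an edge between $(u,w)$ and $(u,w')$ for each $u\in V(G)$ and $ww'\in E(H)$. If $G$, $H$ have label sets $X$, $B$, then $G*H$ has label set $B\times X$, where $(u,w)$ gets the label $(b,x)$ with $b$ the label of $w$ and $x$ the label of $u$. $G*H$ is rooted at the vertex labeled $(j,i)$. *)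

theory Defs
  imports "HOL-Algebra.Generated_Groups" "HOL-Algebra.Sym_Groups"
begin

record ('v, 'x) lgraph =
  verts :: "'v set"
  edges :: "'v set set"
  labels :: "'x set"
  lab :: "'v \<Rightarrow> 'x"

definition labeled_graph :: "('v, 'x) lgraph \<Rightarrow> bool" where
  "labeled_graph G \<longleftrightarrow>
     finite (verts G) \<and>
     (\<forall>e\<in>edges G. \<exists>u v. u \<in> verts G \<and> v \<in> verts G \<and> u \<noteq> v \<and> e = {u, v}) \<and>
     bij_betw (lab G) (verts G) (labels G)"

definition rooted_labeled_graph :: "('v, 'x) lgraph \<Rightarrow> 'x \<Rightarrow> bool" where
  "rooted_labeled_graph G i \<longleftrightarrow> labeled_graph G \<and> i \<in> labels G"

definition vtx :: "('v, 'x) lgraph \<Rightarrow> 'x \<Rightarrow> 'v" where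
  "vtx G x = the_inv_into (verts G) (lab G) x"

definition label_edges :: "('v, 'x) lgraph \<Rightarrow> 'x set set" where
  "label_edges G =
     {{i, j} | i j. i \<in> labels G \<and> j \<in> labels G \<and> {vtx G i, vtx G j} \<in> edges G}"

definition complement_edges :: "('v, 'x) lgraph \<Rightarrow> 'v set set" where
  "complement_edges G = {{u, v} | u v. u \<in> verts G \<and> v \<in> verts G \<and> u \<noteq> v} - edges G"

definition graph_isomorphic :: "('v, 'x) lgraph \<Rightarrow> ('w, 'y) lgraph \<Rightarrow> bool" where
  "graph_isomorphic G H \<longleftrightarrow>
     (\<exists>f. bij_betw f (verts G) (verts H) \<and>
        (\<forall>u\<in>verts G. \<forall>v\<in>verts G. {u, v} \<in> edges G \<longleftrightarrow> {f u, f v} \<in> edges H))"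

definition perm_graph :: "('v, 'x) lgraph \<Rightarrow> ('x \<Rightarrow> 'x) \<Rightarrow> ('v, 'x) lgraph" where
  "perm_graph G \<sigma> = G\<lparr>edges :=
     {{vtx G i, vtx G j} | i j. i \<in> labels G \<and> j \<in> labels G \<and> {\<sigma> i, \<sigma> j} \<in> label_edges G}\<rparr>"

definition Aut :: "('v, 'x) lgraph \<Rightarrow> ('x \<Rightarrow> 'x) set" where
  "Aut G = {\<sigma>. \<sigma> permutes labels G \<and> perm_graph G \<sigma> = G}"

text \<open>In \<open>Replace e e'\<close> the arguments are two-element sets of labels:
  \<open>Replace {r, s} {k, l}\<close> stands for \<open>rs \<rightarrow> kl\<close>, and \<open>Neutral\<close> for \<open>\<emptyset> \<rightarrow> \<emptyset>\<close>.\<close>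

datatype 'x replacement = Neutral | Replace "'x set" "'x set"

definition replace_edge :: "('v, 'x) lgraph \<Rightarrow> 'x set \<Rightarrow> 'x set \<Rightarrow> ('v, 'x) lgraph" where
  "replace_edge G e e' = G\<lparr>edges := (edges G - {vtx G ` e}) \<union> {vtx G ` e'}\<rparr>"

definition edge_replacement :: "('v, 'x) lgraph \<Rightarrow> 'x set \<Rightarrow> 'x set \<Rightarrow> bool" where
  "edge_replacement G e e' \<longleftrightarrow>
     e \<subseteq> labels G \<and> vtx G ` e \<in> edges G \<and>
     e' \<subseteq> labels G \<and> vtx G ` e' \<in> complement_edges G \<union> {vtx G ` e}"

definition feasible :: "('v, 'x) lgraph \<Rightarrow> 'x set \<Rightarrow> 'x set \<Rightarrow> bool" where
  "feasible G e e' \<longleftrightarrow> edge_replacement G e e' \<and> graph_isomorphic (replace_edge G e e') G"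

definition feasible_replacements :: "('v, 'x) lgraph \<Rightarrow> 'x replacement set" where
  "feasible_replacements G = {Replace e e' | e e'. feasible G e e' \<and> e \<noteq> e'} \<union> {Neutral}"

fun Fer :: "('v, 'x) lgraph \<Rightarrow> 'x replacement \<Rightarrow> ('x \<Rightarrow> 'x) set" where
  "Fer G (Replace e e') =
     {\<sigma>. \<sigma> permutes labels G \<and> perm_graph G \<sigma> = replace_edge G e e'}"
| "Fer G Neutral = Aut G"

definition Fer_union :: "('v, 'x) lgraph \<Rightarrow> ('x \<Rightarrow> 'x) set" where
  "Fer_union G = (\<Union>r\<in>feasible_replacements G. Fer G r)"

definition Fer_union_fixing :: "('v, 'x) lgraph \<Rightarrow> 'x \<Rightarrow> ('x \<Rightarrow> 'x) set" where
  "Fer_union_fixing G i = {\<sigma> \<in> Fer_union G. \<sigma> i = i}"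

text \<open>The symmetric group on an arbitrary set, in the style of \<^const>\<open>sym_group\<close>.\<close>

definition Sym :: "'x set \<Rightarrow> ('x \<Rightarrow> 'x) monoid" where
  "Sym X = \<lparr>carrier = {\<sigma>. \<sigma> permutes X}, mult = (\<circ>), one = id\<rparr>"

definition Fer_stem :: "('v, 'x) lgraph \<Rightarrow> 'x \<Rightarrow> ('x \<Rightarrow> 'x) monoid" where
  "Fer_stem G i = (Sym (labels G))\<lparr>carrier := generate (Sym (labels G)) (Fer_union_fixing G i)\<rparr>"

definition stem_symmetric :: "('v, 'x) lgraph \<Rightarrow> 'x \<Rightarrow> bool" where
  "stem_symmetric G i \<longleftrightarrow> Fer_stem G i \<cong> sym_group (card (verts G) - 1)"

definition root_similar_vertex :: "('v, 'x) lgraph \<Rightarrow> 'x \<Rightarrow> 'v \<Rightarrow> bool" where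
  "root_similar_vertex G k v \<longleftrightarrow>
     v \<in> verts G \<and> lab G v \<noteq> k \<and> (\<exists>\<phi>\<in>Aut G. \<phi> k = lab G v)"

text \<open>The added isolated vertex and its label are \<open>None\<close>; a root label \<open>k\<close> becomes \<open>Some k\<close>.\<close>

definition add_isolated :: "('v, 'x) lgraph \<Rightarrow> ('v option, 'x option) lgraph" where
  "add_isolated G =
     \<lparr>verts = insert None (Some ` verts G),
      edges = (\<lambda>e. Some ` e) ` edges G,
      labels = insert None (Some ` labels G),
      lab = map_option (lab G)\<rparr>"

text \<open>The root of the second factor is the vertex labeled \<open>j\<close>. Note the order: vertices are in
  \<open>V(G) \<times> V(H)\<close>, but labels are in \<open>B \<times> X\<close>, with the label of the \<open>H\<close>-component first.\<close>

definition comb_product ::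
  "('v, 'x) lgraph \<Rightarrow> ('w, 'b) lgraph \<Rightarrow> 'b \<Rightarrow> ('v \<times> 'w, 'b \<times> 'x) lgraph" where
  "comb_product G H j =
     \<lparr>verts = verts G \<times> verts H,
      edges = {{(u, vtx H j), (u', vtx H j)} | u u'. {u, u'} \<in> edges G} \<union>
              {{(u, w), (u, w')} | u w w'. u \<in> verts G \<and> {w, w'} \<in> edges H},
      labels = labels H \<times> labels G,
      lab = (\<lambda>(u, w). (lab H w, lab G u))\<rparr>"

lemma group_Sym: "group (Sym X)"
  by (rule groupI)
     (auto simp: Sym_def permutes_compose permutes_id comp_assoc
       intro: permutes_inv permutes_inv_o(2))

lemma labeled_graph_add_isolated:
  assumes "labeled_graph G"
  shows "labeled_graph (add_isolated G)"
proof -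
  have "bij_betw (map_option (lab G)) (insert None (Some ` verts G)) (insert None (Some ` labels G))"
  proof (rule bij_betw_imageI)
    have b: "bij_betw (lab G) (verts G) (labels G)"
      using assms unfolding labeled_graph_def by simp
    then show "inj_on (map_option (lab G)) (insert None (Some ` verts G))"
      unfolding bij_betw_def by (auto simp: inj_on_def)
    from b have L: "labels G = lab G ` verts G"
      unfolding bij_betw_def by simp
    show "map_option (lab G) ` insert None (Some ` verts G) = insert None (Some ` labels G)"
      unfolding L by (simp add: image_image)
  qed
  moreover have "\<exists>u v. u \<in> verts (add_isolated G) \<and> v \<in> verts (add_isolated G) \<and>
      u \<noteq> v \<and> e = {u, v}" if "e \<in> edges (add_isolated G)" for e
  proof -
    from that obtain d where d: "d \<in> edges G" "e = Some ` d"
      by (auto simp: add_isolated_def)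
    have "\<exists>u v. u \<in> verts G \<and> v \<in> verts G \<and> u \<noteq> v \<and> d = {u, v}"
      using assms d(1) unfolding labeled_graph_def by simp
    then obtain u v where "u \<in> verts G" "v \<in> verts G" "u \<noteq> v" "d = {u, v}"
      by (elim exE conjE)
    with d(2) show ?thesis
      by (intro exI[of _ "Some u"] exI[of _ "Some v"]) (simp add: add_isolated_def)
  qed
  moreover have "finite (verts (add_isolated G))"
    using assms unfolding labeled_graph_def by (simp add: add_isolated_def)
  ultimately show ?thesis
    unfolding labeled_graph_def by (simp add: add_isolated_def)
qed

lemma labeled_graph_comb_product:
  assumes G: "labeled_graph G" and H: "rooted_labeled_graph H j"
  shows "labeled_graph (comb_product G H j)"
proof -
  have bG: "bij_betw (lab G) (verts G) (labels G)" and bH: "bij_betw (lab H) (verts H) (labels H)"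
    and j: "j \<in> labels H"
    using assms unfolding rooted_labeled_graph_def labeled_graph_def by auto
  have r: "vtx H j \<in> verts H"
    using bij_betw_the_inv_into[OF bH] j unfolding vtx_def bij_betw_def by auto
  have eG: "u \<in> verts G \<and> u' \<in> verts G \<and> u \<noteq> u'" if "{u, u'} \<in> edges G" for u u'
    using G that unfolding labeled_graph_def by (metis doubleton_eq_iff)
  have eH: "u \<in> verts H \<and> u' \<in> verts H \<and> u \<noteq> u'" if "{u, u'} \<in> edges H" for u u'
    using H that unfolding rooted_labeled_graph_def labeled_graph_def by (metis doubleton_eq_iff)
  have "bij_betw (\<lambda>(u, w). (lab H w, lab G u)) (verts G \<times> verts H) (labels H \<times> labels G)"
  proof (rule bij_betw_imageI)
    show "inj_on (\<lambda>(u, w). (lab H w, lab G u)) (verts G \<times> verts H)"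
      using bG bH unfolding bij_betw_def inj_on_def by auto
    have "(\<lambda>(u, w). (lab H w, lab G u)) ` (verts G \<times> verts H) = lab H ` verts H \<times> lab G ` verts G"
      by force
    then show "(\<lambda>(u, w). (lab H w, lab G u)) ` (verts G \<times> verts H) = labels H \<times> labels G"
      using bG bH unfolding bij_betw_def by simp
  qed
  moreover have "\<exists>p q. p \<in> verts G \<times> verts H \<and> q \<in> verts G \<times> verts H \<and> p \<noteq> q \<and> e = {p, q}"
    if e: "e \<in> edges (comb_product G H j)" for e
  proof -
    from e consider u u' where "{u, u'} \<in> edges G" "e = {(u, vtx H j), (u', vtx H j)}"
      | u w w' where "u \<in> verts G" "{w, w'} \<in> edges H" "e = {(u, w), (u, w')}"
      unfolding comb_product_def by auto
    then show ?thesis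
    proof cases
      case 1
      with eG[OF 1(1)] r show ?thesis
        by (intro exI[of _ "(u, vtx H j)"] exI[of _ "(u', vtx H j)"]) simp
    next
      case 2
      with eH[OF 2(2)] show ?thesis
        by (intro exI[of _ "(u, w)"] exI[of _ "(u, w')"]) simp
    qed
  qed
  moreover have "finite (verts G \<times> verts H)"
    using G H unfolding labeled_graph_def rooted_labeled_graph_def by simp
  ultimately show ?thesis
    unfolding labeled_graph_def by (simp add: comb_product_def)
qed

end

theory Submission
  imports Defs
begin

text \<open>
  Since a replacement exchanges one edge, \<open>\<E>\<^sub>G\<close> consists of the permutations \<open>\<sigma>\<close> whose image of the
  edge set \<open>L\<close> has at most one edge outside \<open>L\<close> (near-automorphisms), and stem symmetry says that
  those fixing the root generate its full stabilizer. For \<open>K = (G * H)\<^sup>*\<close> with isolated vertex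
  \<open>\<infinity>\<close> it therefore suffices to generate all transpositions of \<open>\<infinity>\<close> with a non-root label.

  For \<open>b \<noteq> j\<close> the transposition of \<open>\<infinity>\<close> and \<open>(b, x)\<close> comes from the stem symmetry of \<open>H\<^sup>*\<close>, applied to
  the copy of \<open>H\<close> at \<open>x\<close> together with \<open>\<infinity>\<close>. If \<open>y \<noteq> i\<close> has degree at most one in \<open>G\<close>, then the
  root-moving automorphism of \<open>H\<^sup>*\<close>, applied to the copy at \<open>y\<close>, changes at most one edge of \<open>K\<close>; it
  moves \<open>(j, y)\<close> among labels already reached. Finally, let \<open>\<sigma>\<close> be a near-automorphism of \<open>G\<^sup>*\<close>. Then
  \<open>\<sigma> \<infinity>\<close> is \<open>\<infinity>\<close> or has degree at most one, and \<open>\<sigma>\<close> agrees, except at the preimage of \<open>\<infinity>\<close>, with a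
  near-automorphism fixing \<open>\<infinity>\<close>, which lifts to \<open>K\<close> by permuting the copies of \<open>H\<close>. Hence the set of \<open>x\<close>
  for which \<open>(j, x)\<close> is reached, together with \<open>\<infinity>\<close>, is closed under the generators for \<open>G\<^sup>*\<close>, which
  act transitively off the root. If \<open>H\<close> is a single vertex, \<open>K\<close> is just \<open>G\<^sup>*\<close>.
\<close>

section \<open>Subgroups of symmetric groups\<close>

lemma Sym_simps [simp]:
  "carrier (Sym Y) = {\<sigma>. \<sigma> permutes Y}" "mult (Sym Y) = (\<circ>)" "one (Sym Y) = id"
  by (simp_all add: Sym_def)

lemma m_inv_Sym:
  assumes "\<sigma> permutes Y"
  shows "inv\<^bsub>Sym Y\<^esub> \<sigma> = inv' \<sigma>"
  by (rule group.inv_equality[OF group_Sym])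
    (use assms in \<open>auto simp: permutes_inv permutes_inv_o\<close>)

lemma Sym_subgroupI:
  assumes "\<And>\<sigma>. \<sigma> \<in> P \<Longrightarrow> \<sigma> permutes Y"
    and "id \<in> P"
    and "\<And>\<sigma> \<tau>. \<sigma> \<in> P \<Longrightarrow> \<tau> \<in> P \<Longrightarrow> \<sigma> \<circ> \<tau> \<in> P"
    and "\<And>\<sigma>. \<sigma> \<in> P \<Longrightarrow> inv' \<sigma> \<in> P"
  shows "subgroup P (Sym Y)"
  by (rule group.subgroupI[OF group_Sym])
    (use assms in \<open>auto simp: m_inv_Sym\<close>)

lemma Sym_subgroupD:
  assumes "subgroup P (Sym Y)"
  shows "\<sigma> \<in> P \<Longrightarrow> \<sigma> permutes Y"
    and "id \<in> P"
    and "\<sigma> \<in> P \<Longrightarrow> \<tau> \<in> P \<Longrightarrow> \<sigma> \<circ> \<tau> \<in> P"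
    and "\<sigma> \<in> P \<Longrightarrow> inv' \<sigma> \<in> P"
proof -
  show *: "\<sigma> \<in> P \<Longrightarrow> \<sigma> permutes Y" for \<sigma>
    using subgroup.subset[OF assms] by auto
  show "id \<in> P"
    using subgroup.one_closed[OF assms] by simp
  show "\<sigma> \<in> P \<Longrightarrow> \<tau> \<in> P \<Longrightarrow> \<sigma> \<circ> \<tau> \<in> P"
    using subgroup.m_closed[OF assms] by simp
  show "\<sigma> \<in> P \<Longrightarrow> inv' \<sigma> \<in> P"
    using subgroup.m_inv_closed[OF assms, of \<sigma>] * by (simp add: m_inv_Sym)
qed

lemma permutes_Diff_singleton_iff:
  "\<sigma> permutes (Y - {r}) \<longleftrightarrow> \<sigma> permutes Y \<and> \<sigma> r = r"
proof
  assume "\<sigma> permutes (Y - {r})"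
  then show "\<sigma> permutes Y \<and> \<sigma> r = r"
    by (auto intro: permutes_subset simp: permutes_not_in)
next
  assume "\<sigma> permutes Y \<and> \<sigma> r = r"
  then show "\<sigma> permutes (Y - {r})"
    by (auto intro: permutes_superset)
qed

lemma subgroup_Sym_stabilizer: "subgroup {\<sigma>. \<sigma> permutes (Y - {r})} (Sym Y)"
  by (rule Sym_subgroupI)
    (auto intro: permutes_compose permutes_inv permutes_id permutes_subset)

text \<open>Conjugating the transposition of \<open>a\<close> and \<open>b\<close> by
  \<open>g\<close> relabels it to the transposition of \<open>g a\<close> and
  \<open>g b\<close>.\<close>

lemma transpose_conj_mem:
  assumes P: "subgroup P (Sym Y)" and g: "g \<in> P" and t: "Transposition.transpose a b \<in> P"
  shows "Transposition.transpose (g a) (g b) \<in> P"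
proof -
  have bij: "bij g"
    using Sym_subgroupD(1)[OF P g] by (rule permutes_bij)
  have "g \<circ> Transposition.transpose a b \<circ> inv' g \<in> P"
    by (intro Sym_subgroupD[OF P] g t)
  also have "g \<circ> Transposition.transpose a b \<circ> inv' g = Transposition.transpose (g a) (g b)"
  proof
    fix x
    show "(g \<circ> Transposition.transpose a b \<circ> inv' g) x = Transposition.transpose (g a) (g b) x"
      using transpose_apply_commute[OF bij, of "g a" "g b" "inv' g x"] bij
      by (simp add: bij_is_inj bij_is_surj surj_f_inv_f)
  qed
  finally show ?thesis .
qed

text \<open>Conjugating the second transposition by the first replaces \<open>b\<close> by
  \<open>a\<close> and keeps \<open>c\<close>, unless \<open>c\<close> is \<open>a\<close> or
  \<open>b\<close>; those cases are immediate.\<close>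

lemma transpose_trans_mem:
  assumes P: "subgroup P (Sym Y)"
    and ab: "Transposition.transpose a b \<in> P" and bc: "Transposition.transpose b c \<in> P"
  shows "Transposition.transpose a c \<in> P"
proof (cases "c = a \<or> c = b")
  case True
  with ab Sym_subgroupD(2)[OF P] show ?thesis by auto
next
  case False
  with transpose_conj_mem[OF P ab bc] show ?thesis by simp
qed

text \<open>Transpositions through the common point \<open>c\<close> give every transposition within
  \<open>A\<close>, and permutations of a finite set are products of these.\<close>

lemma permutes_mem_if_transposes_mem:
  assumes P: "subgroup P (Sym Y)" and "finite A"
    and t: "\<And>a. a \<in> A \<Longrightarrow> Transposition.transpose c a \<in> P"
    and "\<sigma> permutes A"
  shows "\<sigma> \<in> P"
  using assms(4) assms(2)
proof (induction rule: permutes_induct)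
  case id
  show ?case by (rule Sym_subgroupD(2)[OF P])
next
  case (swap a b p)
  have "Transposition.transpose a b \<in> P"
    using t[OF \<open>a \<in> A\<close>] t[OF \<open>b \<in> A\<close>] transpose_trans_mem[OF P, of a c b]
    by (simp add: transpose_commute)
  with swap show ?case by (intro Sym_subgroupD[OF P])
qed

section \<open>Transport of permutations along an injection\<close>

lemma map_permutation_inv:
  assumes "inj_on f A" and "\<sigma> permutes A"
  shows "map_permutation A f (inv' \<sigma>) = inv' (map_permutation A f \<sigma>)"
proof (rule sym, rule inv_unique_comp)
  show "map_permutation A f \<sigma> \<circ> map_permutation A f (inv' \<sigma>) = id"
    using assms map_permutation_compose'[of f A "inv' \<sigma>" \<sigma>]
    by (simp add: permutes_inv permutes_inv_o map_permutation_id')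
  show "map_permutation A f (inv' \<sigma>) \<circ> map_permutation A f \<sigma> = id"
    using assms map_permutation_compose'[of f A \<sigma> "inv' \<sigma>"]
    by (simp add: permutes_inv_o map_permutation_id')
qed

text \<open>Transport along \<open>f\<close> respects composition and inverses, so the permutations
  transported into \<open>P\<close> form a subgroup and only generators have to be checked.\<close>

lemma map_permutation_generate_mem:
  assumes f: "inj_on f A" and P: "subgroup P (Sym Y)"
    and E: "\<And>\<sigma>. \<sigma> \<in> E \<Longrightarrow> \<sigma> permutes A \<and> map_permutation A f \<sigma> \<in> P"
    and \<sigma>: "\<sigma> \<in> generate (Sym A) E"
  shows "map_permutation A f \<sigma> \<in> P"
proof -
  let ?Q = "{\<sigma>. \<sigma> permutes A \<and> map_permutation A f \<sigma> \<in> P}"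
  have "subgroup ?Q (Sym A)"
    by (rule Sym_subgroupI)
      (auto simp: f P permutes_id permutes_compose permutes_inv map_permutation_id'
        map_permutation_compose' map_permutation_inv Sym_subgroupD[OF P])
  then have "generate (Sym A) E \<subseteq> ?Q"
    by (intro group.generate_subgroup_incl[OF group_Sym]) (use E in auto)
  with \<sigma> show ?thesis by auto
qed

text \<open>Conjugation by an enumeration of \<open>Y - {r}\<close> is the isomorphism; this fixes
  the order that a stem-symmetric group must have.\<close>

lemma Sym_stabilizer_iso_sym_group:
  assumes "finite Y" and "r \<in> Y"
  shows "(Sym Y)\<lparr>carrier := {\<sigma>. \<sigma> permutes (Y - {r})}\<rparr> \<cong> sym_group (card Y - 1)"
proof -
  have "card (Y - {r}) = card {1..card Y - 1}"
    using assms by simp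
  then obtain f where f: "bij_betw f (Y - {r}) {1..card Y - 1}"
    using assms(1) finite_same_card_bij by (metis finite_Diff finite_atLeastAtMost)
  let ?h = "map_permutation (Y - {r}) f"
  have inj: "inj_on f (Y - {r})"
    using f by (rule bij_betw_imp_inj_on)
  have g: "bij_betw (inv_into (Y - {r}) f) {1..card Y - 1} (Y - {r})"
    by (rule bij_betw_inv_into[OF f])
  show ?thesis
  proof (rule is_isoI[of ?h], rule isoI)
    show "?h \<in> hom ((Sym Y)\<lparr>carrier := {\<sigma>. \<sigma> permutes (Y - {r})}\<rparr>) (sym_group (card Y - 1))"
      by (rule homI)
        (auto simp: sym_group_def map_permutation_compose'[OF inj] simp del: One_nat_def
          intro: map_permutation_permutes[OF f])
    have "bij_betw ?h {\<sigma>. \<sigma> permutes (Y - {r})} {\<sigma>. \<sigma> permutes {1..card Y - 1}}"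
    proof (rule bij_betw_byWitness[where f' = "map_permutation {1..card Y - 1} (inv_into (Y - {r}) f)"])
      show "\<forall>\<sigma>\<in>{\<sigma>. \<sigma> permutes (Y - {r})}.
          map_permutation {1..card Y - 1} (inv_into (Y - {r}) f) (?h \<sigma>) = \<sigma>"
        using map_permutation_compose_inv[OF f] inj by simp
      show "\<forall>\<sigma>\<in>{\<sigma>. \<sigma> permutes {1..card Y - 1}}.
          ?h (map_permutation {1..card Y - 1} (inv_into (Y - {r}) f) \<sigma>) = \<sigma>"
        using map_permutation_compose_inv[OF g] bij_betw_inv_into_right[OF f] by simp
    qed (use map_permutation_permutes[OF f] map_permutation_permutes[OF g] in auto)
    then show "bij_betw ?h (carrier ((Sym Y)\<lparr>carrier := {\<sigma>. \<sigma> permutes (Y - {r})}\<rparr>))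
        (carrier (sym_group (card Y - 1)))"
      by (simp add: sym_group_def)
  qed
qed

text \<open>An abstract isomorphism determines the order of the generated group. As that group lies
  in the finite stabilizer of \<open>r\<close>, which has the same order, the two coincide.\<close>

lemma generate_iso_sym_group_iff:
  assumes "finite Y" and "r \<in> Y" and E: "E \<subseteq> {\<sigma>. \<sigma> permutes (Y - {r})}"
  shows "(Sym Y)\<lparr>carrier := generate (Sym Y) E\<rparr> \<cong> sym_group (card Y - 1) \<longleftrightarrow>
    generate (Sym Y) E = {\<sigma>. \<sigma> permutes (Y - {r})}"
proof
  let ?St = "{\<sigma>. \<sigma> permutes (Y - {r})}"
  assume iso: "(Sym Y)\<lparr>carrier := generate (Sym Y) E\<rparr> \<cong> sym_group (card Y - 1)"
  have sub: "generate (Sym Y) E \<subseteq> ?St"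
    by (rule group.generate_subgroup_incl[OF group_Sym E subgroup_Sym_stabilizer])
  have "card (generate (Sym Y) E) = card (carrier (sym_group (card Y - 1)))"
    using iso_same_card[OF iso] by simp
  also have "\<dots> = card ?St"
    using iso_same_card[OF Sym_stabilizer_iso_sym_group[OF assms(1,2)]] by simp
  finally show "generate (Sym Y) E = ?St"
    using assms(1) sub by (intro card_subset_eq finite_permutations) auto
next
  assume "generate (Sym Y) E = {\<sigma>. \<sigma> permutes (Y - {r})}"
  then show "(Sym Y)\<lparr>carrier := generate (Sym Y) E\<rparr> \<cong> sym_group (card Y - 1)"
    using Sym_stabilizer_iso_sym_group[OF assms(1,2)] by simp
qed

section \<open>Near-automorphisms and stem symmetry\<close>

text \<open>For the edge set of a graph, a count of 0 means an automorphism and a count of 1 a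
  proper edge-replacement, so one bound covers both kinds.\<close>

definition near_automorphisms :: "'a set \<Rightarrow> 'a set set \<Rightarrow> ('a \<Rightarrow> 'a) set" where
  "near_automorphisms Y L = {\<sigma>. \<sigma> permutes Y \<and> card ((`) \<sigma> ` L - L) \<le> 1}"

lemma inj_image:
  assumes "inj f"
  shows "inj ((`) f)"
  by (rule injI) (simp add: inj_image_eq_iff[OF assms])

text \<open>An injection preserves the number of edges, so as many edges are lost as gained.\<close>

lemma card_image_Diff:
  assumes "inj \<sigma>" and "finite L"
  shows "card ((`) \<sigma> ` L - L) = card (L - (`) \<sigma> ` L)"
proof -
  have "inj ((`) \<sigma>)"
    using assms(1) by (rule inj_image)
  then have "card ((`) \<sigma> ` L) = card L"
    by (rule card_image[OF inj_on_subset[OF _ subset_UNIV]])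
  then show ?thesis
    using assms(2) by (simp add: card_Diff_subset_Int Int_commute)
qed

section \<open>Passage between vertices and labels\<close>

lemma labeled_graphD:
  assumes "labeled_graph G"
  shows "finite (labels G)" "finite (verts G)" "card (labels G) = card (verts G)"
    "bij_betw (vtx G) (labels G) (verts G)"
    "x \<in> labels G \<Longrightarrow> lab G (vtx G x) = x"
    "v \<in> verts G \<Longrightarrow> vtx G (lab G v) = v"
    "v \<in> verts G \<Longrightarrow> lab G v \<in> labels G"
    "e \<in> edges G \<Longrightarrow> \<exists>u v. u \<in> verts G \<and> v \<in> verts G \<and> u \<noteq> v \<and> e = {u, v}"
proof -
  have b: "bij_betw (lab G) (verts G) (labels G)" and f: "finite (verts G)"
    using assms by (simp_all add: labeled_graph_def)
  show "finite (verts G)" by fact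
  show "finite (labels G)" using b f bij_betw_finite by blast
  show "card (labels G) = card (verts G)" using bij_betw_same_card[OF b] by simp
  show "bij_betw (vtx G) (labels G) (verts G)"
    using bij_betw_the_inv_into[OF b] by (simp add: vtx_def[abs_def])
  show "x \<in> labels G \<Longrightarrow> lab G (vtx G x) = x"
    using b by (auto simp: vtx_def bij_betw_def f_the_inv_into_f)
  show "v \<in> verts G \<Longrightarrow> vtx G (lab G v) = v"
    using b by (auto simp: vtx_def bij_betw_def the_inv_into_f_f)
  show "v \<in> verts G \<Longrightarrow> lab G v \<in> labels G"
    using b by (auto simp: bij_betw_def)
  show "e \<in> edges G \<Longrightarrow> \<exists>u v. u \<in> verts G \<and> v \<in> verts G \<and> u \<noteq> v \<and> e = {u, v}"
    using assms unfolding labeled_graph_def by blast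
qed

lemma label_edges_conv_image:
  assumes "labeled_graph G"
  shows "label_edges G = (`) (lab G) ` edges G"
proof (intro subset_antisym subsetI)
  fix e
  assume "e \<in> label_edges G"
  then obtain a b where "a \<in> labels G" "b \<in> labels G" "{vtx G a, vtx G b} \<in> edges G" "e = {a, b}"
    by (auto simp: label_edges_def)
  then show "e \<in> (`) (lab G) ` edges G"
    by (intro image_eqI[of _ _ "{vtx G a, vtx G b}"]) (simp_all add: labeled_graphD(5)[OF assms])
next
  fix e
  assume "e \<in> (`) (lab G) ` edges G"
  then obtain d where d: "d \<in> edges G" "e = lab G ` d" by auto
  obtain u v where "u \<in> verts G" "v \<in> verts G" "d = {u, v}"
    using labeled_graphD(8)[OF assms d(1)] by (elim exE conjE)
  with d show "e \<in> label_edges G"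
    unfolding label_edges_def
    by (intro CollectI exI[of _ "lab G u"] exI[of _ "lab G v"]) (simp_all add: labeled_graphD(6,7)[OF assms])
qed

lemma card_label_edge:
  assumes "labeled_graph G" and "e \<in> label_edges G"
  shows "card e = 2"
proof -
  obtain d where d: "d \<in> edges G" "e = lab G ` d"
    using assms(2) by (auto simp: label_edges_conv_image[OF assms(1)])
  obtain u v where uv: "u \<in> verts G" "v \<in> verts G" "u \<noteq> v" "d = {u, v}"
    using labeled_graphD(8)[OF assms(1) d(1)] by (elim exE conjE)
  have "lab G u \<noteq> lab G v"
    using uv labeled_graphD(6)[OF assms(1)] by metis
  with d(2) uv(4) show ?thesis
    by simp
qed

lemma label_edges_subset_Pow: "label_edges G \<subseteq> Pow (labels G)"
  by (auto simp: label_edges_def)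

lemma finite_label_edges:
  assumes "labeled_graph G"
  shows "finite (label_edges G)"
  using labeled_graphD(1)[OF assms] label_edges_subset_Pow[of G] by (meson finite_Pow_iff finite_subset)

lemma vtx_image_lab_image:
  assumes "labeled_graph G" and "d \<subseteq> verts G"
  shows "vtx G ` lab G ` d = d"
  using assms(2) by (force simp: labeled_graphD(6)[OF assms(1)] image_image subset_iff)

lemma lab_image_vtx_image:
  assumes "labeled_graph G" and "e \<subseteq> labels G"
  shows "lab G ` vtx G ` e = e"
  using assms(2) by (force simp: labeled_graphD(5)[OF assms(1)] image_image subset_iff)

lemma edges_conv_image:
  assumes "labeled_graph G"
  shows "edges G = (`) (vtx G) ` label_edges G"
proof -
  have "vtx G ` lab G ` d = d" if "d \<in> edges G" for d
    using labeled_graphD(8)[OF assms that] by (intro vtx_image_lab_image[OF assms]) auto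
  then show ?thesis
    by (simp add: label_edges_conv_image[OF assms] image_image cong: image_cong)
qed

lemma vtx_image_eq_iff:
  assumes "labeled_graph G" and "M \<subseteq> Pow (labels G)" and "N \<subseteq> Pow (labels G)"
  shows "(`) (vtx G) ` M = (`) (vtx G) ` N \<longleftrightarrow> M = N"
proof -
  have "inj_on ((`) (vtx G)) (Pow (labels G))"
    using labeled_graphD(4)[OF assms(1)] by (simp add: bij_betw_def inj_on_image_Pow)
  then show ?thesis
    using assms(2,3) by (rule inj_on_image_eq_iff)
qed

text \<open>Edges of \<open>perm_graph G \<sigma>\<close> are pulled back along
  \<open>\<sigma>\<close>, which is why the inverse acts on the label edges.\<close>

lemma edges_perm_graph:
  assumes "labeled_graph G" and "\<sigma> permutes labels G"
  shows "edges (perm_graph G \<sigma>) = (`) (vtx G) ` (`) (inv' \<sigma>) ` label_edges G"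
proof (intro subset_antisym subsetI)
  fix d
  assume "d \<in> edges (perm_graph G \<sigma>)"
  then obtain a b where ab: "{\<sigma> a, \<sigma> b} \<in> label_edges G" "d = {vtx G a, vtx G b}"
    by (auto simp: perm_graph_def)
  then have "d = vtx G ` inv' \<sigma> ` {\<sigma> a, \<sigma> b}"
    by (simp add: permutes_inverses[OF assms(2)])
  with ab show "d \<in> (`) (vtx G) ` (`) (inv' \<sigma>) ` label_edges G" by blast
next
  fix d
  assume "d \<in> (`) (vtx G) ` (`) (inv' \<sigma>) ` label_edges G"
  then obtain e where e: "e \<in> label_edges G" "d = vtx G ` inv' \<sigma> ` e" by auto
  then obtain a b where "a \<in> labels G" "b \<in> labels G" "e = {a, b}"
    by (auto simp: label_edges_def)
  with e show "d \<in> edges (perm_graph G \<sigma>)"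
    unfolding perm_graph_def
    by (simp, intro exI[of _ "inv' \<sigma> a"] exI[of _ "inv' \<sigma> b"])
      (simp add: permutes_inverses[OF assms(2)] permutes_in_image[OF permutes_inv[OF assms(2)]])
qed

lemma perm_graph_eq_iff:
  assumes "labeled_graph G" and "\<sigma> permutes labels G" and "M \<subseteq> Pow (labels G)"
  shows "perm_graph G \<sigma> = G\<lparr>edges := (`) (vtx G) ` M\<rparr> \<longleftrightarrow> (`) (inv' \<sigma>) ` label_edges G = M"
proof -
  have "(`) (inv' \<sigma>) ` label_edges G \<subseteq> Pow (labels G)"
  proof clarify
    fix e x assume "e \<in> label_edges G" "x \<in> e"
    then show "inv' \<sigma> x \<in> labels G"
      using label_edges_subset_Pow permutes_in_image[OF permutes_inv[OF assms(2)]] by fastforce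
  qed
  from vtx_image_eq_iff[OF assms(1) this assms(3)]
  have "edges (perm_graph G \<sigma>) = (`) (vtx G) ` M \<longleftrightarrow> (`) (inv' \<sigma>) ` label_edges G = M"
    by (simp add: edges_perm_graph[OF assms(1,2)])
  moreover have "perm_graph G \<sigma> = G\<lparr>edges := E\<rparr> \<longleftrightarrow> edges (perm_graph G \<sigma>) = E" for E
    by (cases G) (auto simp: perm_graph_def)
  ultimately show ?thesis by simp
qed

lemma Aut_iff:
  assumes "labeled_graph G"
  shows "\<sigma> \<in> Aut G \<longleftrightarrow> \<sigma> permutes labels G \<and> (`) (inv' \<sigma>) ` label_edges G = label_edges G"
proof -
  have "G = G\<lparr>edges := (`) (vtx G) ` label_edges G\<rparr>"
    by (simp add: edges_conv_image[OF assms, symmetric])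
  with perm_graph_eq_iff[OF assms _ label_edges_subset_Pow] show ?thesis
    unfolding Aut_def by auto
qed

lemma perm_graph_eq_replace_edge_iff:
  assumes "labeled_graph G" and "\<sigma> permutes labels G" and "e \<subseteq> labels G" and "e' \<subseteq> labels G"
  shows "perm_graph G \<sigma> = replace_edge G e e' \<longleftrightarrow>
    (`) (inv' \<sigma>) ` label_edges G = label_edges G - {e} \<union> {e'}"
proof -
  have "inj_on ((`) (vtx G)) (Pow (labels G))"
    using labeled_graphD(4)[OF assms(1)] by (simp add: bij_betw_def inj_on_image_Pow)
  then have "(`) (vtx G) ` (label_edges G - {e}) = (`) (vtx G) ` label_edges G - (`) (vtx G) ` {e}"
    by (rule inj_on_image_set_diff) (use label_edges_subset_Pow[of G] assms(3) in auto)
  then have "replace_edge G e e' = G\<lparr>edges := (`) (vtx G) ` (label_edges G - {e} \<union> {e'})\<rparr>"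
    unfolding replace_edge_def by (simp add: edges_conv_image[OF assms(1), symmetric])
  moreover have "label_edges G - {e} \<union> {e'} \<subseteq> Pow (labels G)"
    using label_edges_subset_Pow assms(4) by auto
  ultimately show ?thesis
    using perm_graph_eq_iff[OF assms(1,2)] by metis
qed

text \<open>The vertex map induced by \<open>\<sigma>\<close> is an isomorphism; it supplies the one
  demanded by feasibility.\<close>

lemma graph_isomorphic_perm_graph:
  assumes "labeled_graph G" and "\<sigma> permutes labels G"
  shows "graph_isomorphic (perm_graph G \<sigma>) G"
  unfolding graph_isomorphic_def
proof (intro exI conjI ballI)
  let ?f = "vtx G \<circ> \<sigma> \<circ> lab G"
  have V: "verts (perm_graph G \<sigma>) = verts G"
    by (simp add: perm_graph_def)
  have "bij_betw (lab G) (verts G) (labels G)"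
    using assms(1) by (simp add: labeled_graph_def)
  then show "bij_betw ?f (verts (perm_graph G \<sigma>)) (verts G)"
    unfolding V using labeled_graphD(4)[OF assms(1)] permutes_imp_bij[OF assms(2)]
    by (intro bij_betw_trans)
  fix u v
  assume uv: "u \<in> verts (perm_graph G \<sigma>)" "v \<in> verts (perm_graph G \<sigma>)"
  let ?e = "{lab G u, lab G v}"
  have e: "?e \<subseteq> labels G"
    using uv by (simp add: V labeled_graphD(6,7)[OF assms(1)])
  have \<sigma>e: "\<sigma> ` ?e \<subseteq> labels G"
    using uv by (simp add: V labeled_graphD(6,7)[OF assms(1)] permutes_in_image[OF assms(2)])
  have inj: "inj_on ((`) (vtx G)) (Pow (labels G))"
    using labeled_graphD(4)[OF assms(1)] by (simp add: bij_betw_def inj_on_image_Pow)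
  have mem: "vtx G ` d \<in> (`) (vtx G) ` M \<longleftrightarrow> d \<in> M" if "d \<subseteq> labels G" "M \<subseteq> Pow (labels G)" for d M
    by (rule inj_on_image_mem_iff[OF inj]) (use that in auto)
  have "(`) (inv' \<sigma>) ` label_edges G \<subseteq> Pow (labels G)"
    using label_edges_subset_Pow[of G] permutes_in_image[OF permutes_inv[OF assms(2)]] by fastforce
  moreover have "{u, v} = vtx G ` ?e"
    using uv by (simp add: V labeled_graphD(6,7)[OF assms(1)])
  ultimately have "{u, v} \<in> edges (perm_graph G \<sigma>) \<longleftrightarrow> ?e \<in> (`) (inv' \<sigma>) ` label_edges G"
    by (simp only: edges_perm_graph[OF assms] mem[OF e])
  also have "\<dots> \<longleftrightarrow> \<sigma> ` ?e \<in> label_edges G"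
  proof
    assume "?e \<in> (`) (inv' \<sigma>) ` label_edges G"
    then obtain d where "d \<in> label_edges G" "?e = inv' \<sigma> ` d" by auto
    then show "\<sigma> ` ?e \<in> label_edges G"
      by (simp add: image_image permutes_inverses[OF assms(2)] del: image_insert)
  next
    assume "\<sigma> ` ?e \<in> label_edges G"
    then have "inv' \<sigma> ` \<sigma> ` ?e \<in> (`) (inv' \<sigma>) ` label_edges G" by (rule imageI)
    then show "?e \<in> (`) (inv' \<sigma>) ` label_edges G"
      by (simp add: image_image permutes_inverses[OF assms(2)])
  qed
  also have "\<dots> \<longleftrightarrow> {?f u, ?f v} \<in> edges G"
    using mem[OF \<sigma>e label_edges_subset_Pow] by (simp add: edges_conv_image[OF assms(1)])
  finally show "{u, v} \<in> edges (perm_graph G \<sigma>) \<longleftrightarrow> {?f u, ?f v} \<in> edges G" .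
qed

lemma inv_image_eq_iff:
  assumes "bij \<sigma>"
  shows "(`) (inv' \<sigma>) ` M = N \<longleftrightarrow> M = (`) \<sigma> ` N"
proof -
  have "(`) \<sigma> ` (`) (inv' \<sigma>) ` M = M"
    using assms by (simp add: image_image bij_is_surj surj_f_inv_f)
  moreover have "(`) (inv' \<sigma>) ` (`) \<sigma> ` N = N"
    using assms by (simp add: image_image bij_is_inj)
  ultimately show ?thesis by metis
qed

lemma Aut_iff_image:
  assumes "labeled_graph G"
  shows "\<sigma> \<in> Aut G \<longleftrightarrow> \<sigma> permutes labels G \<and> (`) \<sigma> ` label_edges G = label_edges G"
  using Aut_iff[OF assms] inv_image_eq_iff permutes_bij by metis

text \<open>A replacement allows only the image of the removed edge to leave the edge set.
  Conversely, the inverse permutation loses as many edges as it gains: none gives an automorphism,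
  one of each names the replacement.\<close>

lemma Fer_union_eq_near_automorphisms:
  fixes G :: "('v, 'x) lgraph"
  assumes G: "labeled_graph G"
  shows "Fer_union G = near_automorphisms (labels G) (label_edges G)"
proof (intro subset_antisym subsetI)
  let ?L = "label_edges G"
  fix \<sigma>
  assume "\<sigma> \<in> Fer_union G"
  then obtain r where r: "r \<in> feasible_replacements G" "\<sigma> \<in> Fer G r"
    by (auto simp: Fer_union_def)
  show "\<sigma> \<in> near_automorphisms (labels G) ?L"
  proof (cases r)
    case Neutral
    with r show ?thesis
      by (simp add: Aut_iff_image[OF G] near_automorphisms_def)
  next
    case (Replace e e')
    with r have \<sigma>: "\<sigma> permutes labels G" and eq: "perm_graph G \<sigma> = replace_edge G e e'"
      and e: "e \<subseteq> labels G" "e' \<subseteq> labels G"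
      by (auto simp: feasible_replacements_def feasible_def edge_replacement_def)
    have eq': "?L = (`) \<sigma> ` (?L - {e} \<union> {e'})"
      using iffD1[OF perm_graph_eq_replace_edge_iff[OF G \<sigma> e] eq]
      unfolding inv_image_eq_iff[OF permutes_bij[OF \<sigma>]] .
    have "\<sigma> ` d \<in> ?L" if "d \<in> ?L" "d \<noteq> e" for d
      by (subst eq', rule imageI) (use that in simp)
    then have "(`) \<sigma> ` ?L - ?L \<subseteq> {\<sigma> ` e}" by auto
    then have "card ((`) \<sigma> ` ?L - ?L) \<le> card {\<sigma> ` e}"
      by (intro card_mono) auto
    with \<sigma> show ?thesis
      by (simp add: near_automorphisms_def)
  qed
next
  let ?L = "label_edges G"
  fix \<sigma>
  assume "\<sigma> \<in> near_automorphisms (labels G) ?L"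
  then have \<sigma>: "\<sigma> permutes labels G" and c: "card ((`) \<sigma> ` ?L - ?L) \<le> 1"
    by (auto simp: near_automorphisms_def)
  let ?\<rho> = "inv' \<sigma>"
  have \<rho>: "inj ?\<rho>"
    using permutes_inj[OF permutes_inv[OF \<sigma>]] .
  have fin: "finite ?L"
    by (rule finite_label_edges[OF G])
  \<comment> \<open>The members of \<open>Fer\<close> are described through the inverse, so the
    bound is moved from \<open>\<sigma>\<close> to \<open>?\<rho>\<close>: the edges it loses are
    images of the edges gained by \<open>\<sigma>\<close>.\<close>
  have "?L - (`) ?\<rho> ` ?L = (`) ?\<rho> ` ((`) \<sigma> ` ?L - ?L)"
  proof -
    have "(`) ?\<rho> ` ((`) \<sigma> ` ?L - ?L) = (`) ?\<rho> ` (`) \<sigma> ` ?L - (`) ?\<rho> ` ?L"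
      by (rule image_set_diff[OF inj_image[OF \<rho>]])
    also have "(`) ?\<rho> ` (`) \<sigma> ` ?L = ?L"
      by (simp add: image_image permutes_inverses[OF \<sigma>])
    finally show ?thesis ..
  qed
  with c fin have c1: "card (?L - (`) ?\<rho> ` ?L) \<le> 1"
    using card_image_le[of "(`) \<sigma> ` ?L - ?L" "(`) ?\<rho>"] by simp
  have c2: "card ((`) ?\<rho> ` ?L - ?L) = card (?L - (`) ?\<rho> ` ?L)"
    by (rule card_image_Diff[OF \<rho> fin])
  show "\<sigma> \<in> Fer_union G"
  proof (cases "card (?L - (`) ?\<rho> ` ?L) = 0")
    case True
    with c2 have "card ((`) ?\<rho> ` ?L - ?L) = 0"
      by (rule trans)
    with fin have "(`) ?\<rho> ` ?L \<subseteq> ?L"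
      by (simp only: card_0_eq finite_Diff finite_imageI Diff_eq_empty_iff)
    moreover from True fin have "?L \<subseteq> (`) ?\<rho> ` ?L"
      by simp
    ultimately have "(`) ?\<rho> ` ?L = ?L"
      by (rule subset_antisym)
    then have "\<sigma> \<in> Fer G Neutral"
      by (simp add: Aut_iff[OF G] \<sigma>)
    then show ?thesis
      by (auto simp: Fer_union_def feasible_replacements_def simp del: Fer.simps)
  next
    case False
    with c1 c2 have c: "card (?L - (`) ?\<rho> ` ?L) = 1" "card ((`) ?\<rho> ` ?L - ?L) = 1"
      by linarith+
    obtain e where e: "?L - (`) ?\<rho> ` ?L = {e}"
      using c(1) by (rule card_1_singletonE)
    obtain e' where e': "(`) ?\<rho> ` ?L - ?L = {e'}"
      using c(2) by (rule card_1_singletonE)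
    \<comment> \<open>Any set arises from another by removing one difference and adding the other;
      here both differences are singletons, which is an edge-replacement.\<close>
    have "B = A - (A - B) \<union> (B - A)" for A B :: "'x set set"
      by blast
    from this[of "(`) ?\<rho> ` ?L" ?L] have eq: "(`) ?\<rho> ` ?L = ?L - {e} \<union> {e'}"
      unfolding e e' .
    have eL: "e \<in> ?L" and e'L: "e' \<notin> ?L" and e'\<rho>: "e' \<in> (`) ?\<rho> ` ?L"
      using equalityD2[OF e] equalityD2[OF e']
      by (simp_all only: insert_subset Diff_iff not_False_eq_True)
    have sub: "e \<subseteq> labels G" "e' \<subseteq> labels G"
    proof -
      show "e \<subseteq> labels G" using eL label_edges_subset_Pow[of G] by auto
      obtain d where "d \<in> ?L" and d: "e' = ?\<rho> ` d"
        using e'\<rho> by (rule imageE)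
      then have "d \<subseteq> labels G"
        using label_edges_subset_Pow[of G] by auto
      then show "e' \<subseteq> labels G"
        unfolding d using permutes_in_image[OF permutes_inv[OF \<sigma>]] by auto
    qed
    have pg: "perm_graph G \<sigma> = replace_edge G e e'"
      using perm_graph_eq_replace_edge_iff[OF G \<sigma> sub] eq by simp
    have "vtx G ` e' \<in> complement_edges G"
    proof -
      obtain d where d: "d \<in> ?L" "e' = ?\<rho> ` d"
        using e'\<rho> by (rule imageE)
      have "card e' = 2"
        unfolding d(2) using card_label_edge[OF G d(1)] inj_on_subset[OF \<rho> subset_UNIV]
        by (simp add: card_image)
      then obtain a b where ab: "e' = {a, b}" "a \<noteq> b"
        by (auto simp: card_2_iff)
      with sub(2) have "a \<in> labels G" "b \<in> labels G"
        by auto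
      with ab(2) have "vtx G a \<in> verts G" "vtx G b \<in> verts G" "vtx G a \<noteq> vtx G b"
        using labeled_graphD(4)[OF G] by (auto simp: bij_betw_def inj_on_def)
      moreover have "vtx G ` e' = {vtx G a, vtx G b}"
        using ab(1) by simp
      moreover have "vtx G ` e' \<notin> edges G"
      proof
        assume "vtx G ` e' \<in> edges G"
        then have "lab G ` vtx G ` e' \<in> ?L"
          by (simp add: label_edges_conv_image[OF G])
        with e'L sub show False
          by (simp add: lab_image_vtx_image[OF G])
      qed
      ultimately show ?thesis
        by (auto simp: complement_edges_def)
    qed
    moreover have "vtx G ` e \<in> edges G"
      using eL by (simp add: edges_conv_image[OF G])
    ultimately have "edge_replacement G e e'"
      using sub by (simp add: edge_replacement_def)
    then have "feasible G e e'"
      using graph_isomorphic_perm_graph[OF G \<sigma>] pg by (simp add: feasible_def)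
    moreover have "e \<noteq> e'" using eL e'L by auto
    ultimately have "Replace e e' \<in> feasible_replacements G"
      by (auto simp: feasible_replacements_def)
    moreover have "\<sigma> \<in> Fer G (Replace e e')"
      using \<sigma> pg by simp
    ultimately show ?thesis
      by (auto simp: Fer_union_def simp del: Fer.simps)
  qed
qed

text \<open>A form of \<open>Fer_union_fixing\<close> in terms of labels and label edges alone,
  which frees the combinatorial argument from vertices and graph records.\<close>

definition stem_set :: "'a set \<Rightarrow> 'a set set \<Rightarrow> 'a \<Rightarrow> ('a \<Rightarrow> 'a) set" where
  "stem_set Y L r = {\<sigma> \<in> near_automorphisms Y L. \<sigma> r = r}"

lemma stem_set_subset: "stem_set Y L r \<subseteq> {\<sigma>. \<sigma> permutes (Y - {r})}"
  by (auto simp: stem_set_def near_automorphisms_def permutes_Diff_singleton_iff)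

text \<open>Replaces the isomorphism by an equality of permutation groups, the form in which both
  factors and the comb product are treated.\<close>

lemma stem_symmetric_iff:
  assumes G: "labeled_graph G" and "r \<in> labels G"
  shows "stem_symmetric G r \<longleftrightarrow>
    generate (Sym (labels G)) (stem_set (labels G) (label_edges G) r) =
      {\<sigma>. \<sigma> permutes (labels G - {r})}"
proof -
  have "Fer_union_fixing G r = stem_set (labels G) (label_edges G) r"
    by (simp add: Fer_union_fixing_def Fer_union_eq_near_automorphisms[OF G] stem_set_def)
  then show ?thesis
    using generate_iso_sym_group_iff[OF labeled_graphD(1)[OF G] assms(2) stem_set_subset]
    by (simp add: stem_symmetric_def Fer_stem_def labeled_graphD(3)[OF G])
qed

section \<open>Label edges of the derived graphs\<close>

lemma label_edges_add_isolated:
  assumes "labeled_graph G"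
  shows "label_edges (add_isolated G) = (`) Some ` label_edges G"
  unfolding label_edges_conv_image[OF assms]
    label_edges_conv_image[OF labeled_graph_add_isolated[OF assms]]
  by (simp add: add_isolated_def image_image)

lemma doubletons_conv_image:
  assumes "\<And>e. e \<in> E \<Longrightarrow> \<exists>u v. e = {u, v}"
  shows "{{f u, f v} | u v. {u, v} \<in> E} = (`) f ` E"
proof (intro subset_antisym subsetI)
  fix d
  assume "d \<in> {{f u, f v} | u v. {u, v} \<in> E}"
  then obtain u v where "{u, v} \<in> E" "d = f ` {u, v}"
    unfolding image_insert image_empty by blast
  then show "d \<in> (`) f ` E"
    by (intro image_eqI)
next
  fix d
  assume "d \<in> (`) f ` E"
  then obtain e where e: "e \<in> E" "d = f ` e"
    by (rule imageE)
  obtain u v where "e = {u, v}"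
    using assms[OF e(1)] by (elim exE)
  with e have "{u, v} \<in> E" "d = {f u, f v}"
    by simp_all
  then show "d \<in> {{f u, f v} | u v. {u, v} \<in> E}"
    by (intro CollectI exI conjI)
qed

lemma edges_comb_product:
  assumes G: "labeled_graph G" and H: "labeled_graph H"
  shows "edges (comb_product G H j) =
    (`) (\<lambda>u. (u, vtx H j)) ` edges G \<union> (\<Union>u\<in>verts G. (`) (Pair u) ` edges H)"
proof -
  have eG: "\<exists>u v. e = {u, v}" if "e \<in> edges G" for e
    using labeled_graphD(8)[OF G that] by (elim exE conjE) (intro exI)
  have eH: "\<exists>u v. e = {u, v}" if "e \<in> edges H" for e
    using labeled_graphD(8)[OF H that] by (elim exE conjE) (intro exI)
  have "{{(u, w), (u, w')} | u w w'. u \<in> verts G \<and> {w, w'} \<in> edges H} =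
      (\<Union>u\<in>verts G. {{(u, w), (u, w')} | w w'. {w, w'} \<in> edges H})"
    by blast
  then show ?thesis
    by (simp add: comb_product_def doubletons_conv_image[OF eG] doubletons_conv_image[OF eH])
qed

text \<open>Labels put the \<open>H\<close>-component first, so the edges of \<open>G\<close> sit at
  the constant first coordinate \<open>j\<close> and each copy of \<open>H\<close> at a constant
  second coordinate.\<close>

lemma label_edges_comb_product:
  assumes G: "labeled_graph G" and H: "rooted_labeled_graph H j"
  shows "label_edges (comb_product G H j) =
    (`) (Pair j) ` label_edges G \<union> (\<Union>x\<in>labels G. (`) (\<lambda>b. (b, x)) ` label_edges H)"
proof -
  have H': "labeled_graph H" and "j \<in> labels H"
    using H by (auto simp: rooted_labeled_graph_def)
  then have j: "lab H (vtx H j) = j"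
    by (rule labeled_graphD(5))
  have X: "labels G = lab G ` verts G"
    using G unfolding labeled_graph_def bij_betw_def by (elim conjE) (rule sym)
  have l: "lab (comb_product G H j) = (\<lambda>(u, w). (lab H w, lab G u))"
    by (simp add: comb_product_def)
  have 1: "(`) (lab (comb_product G H j)) ` (`) (\<lambda>u. (u, vtx H j)) ` edges G =
      (`) (Pair j) ` label_edges G"
    unfolding label_edges_conv_image[OF G] image_comp comp_def l by (simp add: j)
  have 2: "(`) (lab (comb_product G H j)) ` (`) (Pair u) ` edges H =
      (`) (\<lambda>b. (b, lab G u)) ` label_edges H" for u
    unfolding label_edges_conv_image[OF H'] image_comp comp_def l by simp
  show ?thesis
    unfolding label_edges_conv_image[OF labeled_graph_comb_product[OF G H]]
      edges_comb_product[OF G H'] image_Un image_UN 1 2 X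
    by (simp only: UN_simps)
qed

section \<open>Construction of near-automorphisms\<close>

lemma map_permutation_outside: "y \<notin> f ` A \<Longrightarrow> map_permutation A f \<sigma> y = y"
  by (simp add: map_permutation_def)

lemma map_permutation_permutes_superset:
  assumes "inj_on f A" and "f ` A \<subseteq> Y" and "\<sigma> permutes A"
  shows "map_permutation A f \<sigma> permutes Y"
  using map_permutation_permutes[OF inj_on_imp_bij_betw[OF assms(1)] assms(3)] assms(2)
  by (rule permutes_subset)

lemma map_permutation_image:
  assumes "inj_on f A" and "d \<subseteq> A"
  shows "map_permutation A f \<sigma> ` f ` d = f ` \<sigma> ` d"
proof -
  have "map_permutation A f \<sigma> (f x) = f (\<sigma> x)" if "x \<in> d" for x
    using map_permutation_apply[OF assms(1)] that assms(2) by blast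
  then show ?thesis
    by (simp add: image_image)
qed

lemma near_automorphismsI:
  assumes "\<sigma> permutes Y" and "(`) \<sigma> ` L - L \<subseteq> D" and "finite D" and "card D \<le> 1"
  shows "\<sigma> \<in> near_automorphisms Y L"
  using card_mono[OF assms(3,2)] assms(1,4) by (simp add: near_automorphisms_def)

text \<open>Edges of \<open>M\<close> stay fixed, and a transported edge of \<open>L\<close> can
  become new only if its image under \<open>\<sigma>\<close> was already new, so transport creates
  no further new edges.\<close>

lemma near_automorphisms_map_permutation:
  assumes f: "inj_on f A" "f ` A \<subseteq> Y" and \<sigma>: "\<sigma> \<in> near_automorphisms A L"
    and L: "L \<subseteq> Pow A" "finite A"
    and M: "\<And>e. e \<in> M \<Longrightarrow> map_permutation A f \<sigma> ` e = e"
  shows "map_permutation A f \<sigma> \<in> near_automorphisms Y ((`) f ` L \<union> M)"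
proof (rule near_automorphismsI)
  let ?D = "(`) \<sigma> ` L - L"
  have fin: "finite ?D"
    using L finite_subset by blast
  have \<sigma>': "\<sigma> permutes A" "card ?D \<le> 1"
    using \<sigma> by (simp_all add: near_automorphisms_def)
  show "map_permutation A f \<sigma> permutes Y"
    using f \<sigma>'(1) by (rule map_permutation_permutes_superset)
  show "(`) (map_permutation A f \<sigma>) ` ((`) f ` L \<union> M) - ((`) f ` L \<union> M) \<subseteq> (`) f ` ?D"
  proof
    fix e
    assume e: "e \<in> (`) (map_permutation A f \<sigma>) ` ((`) f ` L \<union> M) - ((`) f ` L \<union> M)"
    with M obtain d where "d \<in> L" and eq: "e = map_permutation A f \<sigma> ` f ` d"
      by auto
    moreover have "d \<subseteq> A"
      using \<open>d \<in> L\<close> L(1) by auto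
    ultimately have "e = f ` \<sigma> ` d"
      by (simp only: map_permutation_image[OF f(1)])
    moreover from this e have "\<sigma> ` d \<notin> L"
      by blast
    ultimately show "e \<in> (`) f ` ?D"
      using \<open>d \<in> L\<close> by blast
  qed
  show "finite ((`) f ` ?D)"
    using fin by simp
  show "card ((`) f ` ?D) \<le> 1"
    using card_image_le[OF fin, of "(`) f"] \<sigma>'(2) by simp
qed

text \<open>A near-automorphism moving a vertex \<open>c\<close> that lies on no edge can be corrected to one that
  fixes \<open>c\<close>: only edges outside \<open>L\<close> can meet \<open>c\<close> after the move.\<close>

lemma near_automorphisms_fix_isolated:
  assumes \<sigma>: "\<sigma> \<in> near_automorphisms A L" and "c \<in> A" and L: "finite L" "L \<subseteq> Pow (A - {c})"
  shows "Transposition.transpose (\<sigma> c) c \<circ> \<sigma> \<in> near_automorphisms A L"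
proof (rule near_automorphismsI)
  let ?t = "Transposition.transpose (\<sigma> c) c" and ?D = "(`) \<sigma> ` L - L"
  have \<sigma>': "\<sigma> permutes A" "card ?D \<le> 1"
    using \<sigma> by (simp_all add: near_automorphisms_def)
  have "\<sigma> c \<in> A"
    using \<open>c \<in> A\<close> permutes_in_image[OF \<sigma>'(1)] by simp
  then show "?t \<circ> \<sigma> permutes A"
    using \<sigma>'(1) \<open>c \<in> A\<close> by (intro permutes_compose permutes_swap_id)
  show "(`) (?t \<circ> \<sigma>) ` L - L \<subseteq> (`) ?t ` ?D"
  proof
    fix e
    assume e: "e \<in> (`) (?t \<circ> \<sigma>) ` L - L"
    then obtain d where d: "d \<in> L" "e = ?t ` \<sigma> ` d"
      by (auto simp: image_comp)
    have "\<sigma> ` d \<notin> L"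
    proof
      assume in_L: "\<sigma> ` d \<in> L"
      \<comment> \<open>Both \<open>d\<close> and its image lie in \<open>L\<close> and avoid
        \<open>c\<close>, so the image avoids \<open>c\<close> and \<open>\<sigma> c\<close> and the
        transposition leaves it alone.\<close>
      have "c \<notin> d" "c \<notin> \<sigma> ` d"
        using in_L d(1) L(2) by auto
      then have "x \<noteq> c \<and> x \<noteq> \<sigma> c" if "x \<in> \<sigma> ` d" for x
        using that injD[OF permutes_inj[OF \<sigma>'(1)]] by blast
      then have "?t ` \<sigma> ` d = \<sigma> ` d"
        by simp
      with e d in_L show False by auto
    qed
    with d show "e \<in> (`) ?t ` ?D" by blast
  qed
  show "finite ((`) ?t ` ?D)"
    using L(1) by simp
  show "card ((`) ?t ` ?D) \<le> 1"
    using card_image_le[of ?D "(`) ?t"] L(1) \<sigma>'(2) by simp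
qed

text \<open>Since no edge contains \<open>c\<close>, no image of an edge contains
  \<open>\<sigma> c\<close>. All edges at \<open>\<sigma> c\<close> are thus lost, and at most one
  edge is lost because at most one is gained.\<close>

lemma near_automorphisms_degree_le_1:
  assumes \<sigma>: "\<sigma> \<in> near_automorphisms A L" and L: "finite L" "L \<subseteq> Pow (A - {c})"
  shows "card {e \<in> L. \<sigma> c \<in> e} \<le> 1"
proof -
  have \<sigma>': "\<sigma> permutes A" "card ((`) \<sigma> ` L - L) \<le> 1"
    using \<sigma> by (simp_all add: near_automorphisms_def)
  have "\<sigma> c \<notin> \<sigma> ` d" if "d \<in> L" for d
    using that L(2) by (auto simp: inj_image_mem_iff[OF permutes_inj[OF \<sigma>'(1)]])
  then have "{e \<in> L. \<sigma> c \<in> e} \<subseteq> L - (`) \<sigma> ` L"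
    by auto
  then have "card {e \<in> L. \<sigma> c \<in> e} \<le> card (L - (`) \<sigma> ` L)"
    using L(1) by (intro card_mono) auto
  also have "\<dots> = card ((`) \<sigma> ` L - L)"
    by (rule card_image_Diff[OF permutes_inj[OF \<sigma>'(1)] L(1), symmetric])
  finally show ?thesis
    using \<sigma>'(2) by simp
qed

section \<open>The comb product\<close>

text \<open>\<open>LG\<close> and \<open>LH\<close> play the role of the label edges of \<open>G\<^sup>*\<close> and \<open>H\<^sup>*\<close>. The maps \<open>base\<close> and
  \<open>copy x\<close> embed the labels of \<open>G\<^sup>*\<close> and of the copy of \<open>H\<^sup>*\<close> at \<open>x\<close>, sharing the isolated
  vertex \<open>None\<close>.\<close>

locale comb_labels =
  fixes X :: "'x set" and B :: "'b set" and i :: 'x and j :: 'b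
    and LG :: "'x option set set" and LH :: "'b option set set"
  assumes finite_X: "finite X" and finite_B: "finite B" and i: "i \<in> X" and j: "j \<in> B"
    and LG: "LG \<subseteq> Pow (Some ` X)" and LH: "LH \<subseteq> Pow (Some ` B)"
    and card_LH: "\<And>e. e \<in> LH \<Longrightarrow> card e = 2"
begin

abbreviation (input) XN :: "'x option set" where "XN \<equiv> insert None (Some ` X)"
abbreviation (input) BN :: "'b option set" where "BN \<equiv> insert None (Some ` B)"

definition Y :: "('b \<times> 'x) option set" where
  "Y = insert None (Some ` (B \<times> X))"

definition copy :: "'x \<Rightarrow> 'b option \<Rightarrow> ('b \<times> 'x) option" where
  "copy x = map_option (\<lambda>b. (b, x))"

definition base :: "'x option \<Rightarrow> ('b \<times> 'x) option" where
  "base = map_option (Pair j)"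

text \<open>Together, \<open>Y\<close> and \<open>K\<close> encode the comb product with its
  isolated vertex: base edges join roots, and every label in \<open>X\<close> carries a copy of the
  second factor.\<close>

definition K :: "('b \<times> 'x) option set set" where
  "K = (`) base ` LG \<union> (\<Union>x\<in>X. (`) (copy x) ` LH)"

definition P :: "(('b \<times> 'x) option \<Rightarrow> ('b \<times> 'x) option) set" where
  "P = generate (Sym Y) (stem_set Y K (Some (j, i)))"

lemma copy_simps [simp]: "copy x None = None" "copy x (Some b) = Some (b, x)"
  by (simp_all add: copy_def)

lemma base_simps [simp]: "base None = None" "base (Some x) = Some (j, x)"
  by (simp_all add: base_def)

lemma inj_copy: "inj (copy x)"
  unfolding copy_def by (rule option.inj_map) (simp add: inj_def)

lemma inj_base: "inj base"
  unfolding base_def by (rule option.inj_map) (simp add: inj_def)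

lemma copy_BN: "x \<in> X \<Longrightarrow> copy x ` BN \<subseteq> Y"
  by (auto simp: Y_def)

lemma base_XN: "base ` XN \<subseteq> Y"
  using j by (auto simp: Y_def)

lemma inj_on_copy: "inj_on (copy x) A"
  using inj_copy by (rule inj_on_subset) simp

lemma inj_on_base: "inj_on base A"
  using inj_base by (rule inj_on_subset) simp

lemma LG_Pow: "LG \<subseteq> Pow XN" and LH_Pow: "LH \<subseteq> Pow BN" and finite_XN: "finite XN" and finite_BN: "finite BN"
  using LG LH finite_X finite_B by auto

lemma finite_LG: "finite LG"
  using LG finite_X by (meson finite_Pow_iff finite_imageI finite_subset)

lemma subgroup_P: "subgroup P (Sym Y)"
  unfolding P_def using stem_set_subset[of Y K "Some (j, i)"]
  by (intro group.generate_is_subgroup[OF group_Sym])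
    (auto simp: permutes_Diff_singleton_iff)

lemma P_incl: "\<sigma> \<in> near_automorphisms Y K \<Longrightarrow> \<sigma> (Some (j, i)) = Some (j, i) \<Longrightarrow> \<sigma> \<in> P"
  unfolding P_def by (rule generate.incl) (simp add: stem_set_def)

section \<open>Permutations of a single copy of the second factor\<close>

lemma copy_permutation_other:
  "x' \<noteq> x \<Longrightarrow> map_permutation BN (copy x) \<sigma> (Some (b, x')) = Some (b, x')"
  by (rule map_permutation_outside) auto

lemma copy_permutation_copy:
  "p \<in> BN \<Longrightarrow> map_permutation BN (copy x) \<sigma> (copy x p) = copy x (\<sigma> p)"
  by (rule map_permutation_apply[OF inj_on_copy])

lemma copy_permutation_copy_other:
  assumes "x' \<noteq> x" and "d \<in> LH"
  shows "map_permutation BN (copy x) \<sigma> ` copy x' ` d = copy x' ` d"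
proof -
  have "map_permutation BN (copy x) \<sigma> p = p" if "p \<in> copy x' ` d" for p
    using that LH assms copy_permutation_other by fastforce
  then show ?thesis by simp
qed

text \<open>Fixing the root of its copy, the permutation moves no label on a base edge or on an edge
  of another copy; hence all new edges come from the one copy, where \<open>\<sigma>\<close> allows
  at most one.\<close>

lemma copy_permutation_mem_P:
  assumes \<sigma>: "\<sigma> \<in> stem_set BN LH (Some j)" and "x \<in> X"
  shows "map_permutation BN (copy x) \<sigma> \<in> P"
proof (rule P_incl)
  let ?s = "map_permutation BN (copy x) \<sigma>"
  let ?M = "(`) base ` LG \<union> (\<Union>x'\<in>X - {x}. (`) (copy x') ` LH)"
  have \<sigma>': "\<sigma> \<in> near_automorphisms BN LH" "\<sigma> (Some j) = Some j"
    using \<sigma> by (simp_all add: stem_set_def)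
  have root: "?s (Some (j, x')) = Some (j, x')" for x'
    using copy_permutation_other[of x' x \<sigma> j] copy_permutation_copy[of "Some j" x \<sigma>] \<sigma>'(2) j
    by (cases "x' = x") simp_all
  show "?s (Some (j, i)) = Some (j, i)" by (rule root)
  have fix_base: "?s ` base ` d = base ` d" if "d \<in> LG" for d
  proof -
    have "?s p = p" if "p \<in> base ` d" for p
      using that \<open>d \<in> LG\<close> LG root by fastforce
    then show ?thesis by simp
  qed
  have "?s ` e = e" if "e \<in> ?M" for e
  proof -
    from that consider d where "d \<in> LG" "e = base ` d"
      | x' d where "x' \<noteq> x" "d \<in> LH" "e = copy x' ` d"
      by auto
    then show ?thesis
      by cases (simp_all only: fix_base copy_permutation_copy_other not_False_eq_True)
  qed
  from near_automorphisms_map_permutation[OF inj_on_copy copy_BN[OF \<open>x \<in> X\<close>] \<sigma>'(1) LH_Pow finite_BN this]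
  have "?s \<in> near_automorphisms Y ((`) (copy x) ` LH \<union> ?M)" .
  also have "(`) (copy x) ` LH \<union> ?M = K"
    using \<open>x \<in> X\<close> unfolding K_def by auto
  finally show "?s \<in> near_automorphisms Y K" .
qed

lemma transpose_copy_mem_P:
  assumes H: "generate (Sym BN) (stem_set BN LH (Some j)) = {\<sigma>. \<sigma> permutes (BN - {Some j})}"
    and "x \<in> X" and p: "p \<in> BN" "p \<noteq> Some j"
  shows "Transposition.transpose None (copy x p) \<in> P"
proof -
  have "Transposition.transpose None p permutes (BN - {Some j})"
    using p by (intro permutes_swap_id) auto
  then have "Transposition.transpose None p \<in> generate (Sym BN) (stem_set BN LH (Some j))"
    by (simp add: H)
  then have "map_permutation BN (copy x) (Transposition.transpose None p) \<in> P"
    using copy_permutation_mem_P[OF _ \<open>x \<in> X\<close>] stem_set_subset[of BN LH "Some j"]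
    by (intro map_permutation_generate_mem[OF inj_on_copy subgroup_P])
      (auto simp: permutes_Diff_singleton_iff)
  then show ?thesis
    using p(1) by (simp add: map_permutation_transpose[OF inj_on_copy])
qed

text \<open>Applying the root-moving automorphism \<open>\<phi>\<close> to the copy of \<open>H\<^sup>*\<close> at \<open>y\<close> disturbs only the
  edges of \<open>G\<close> at \<open>y\<close>, hence at most one edge.\<close>

lemma transpose_root_copy_mem_P:
  assumes H: "generate (Sym BN) (stem_set BN LH (Some j)) = {\<sigma>. \<sigma> permutes (BN - {Some j})}"
    and \<phi>: "\<phi> permutes BN" "(`) \<phi> ` LH = LH" "\<phi> (Some j) \<noteq> Some j"
    and B: "B \<noteq> {j}" and y: "y \<in> X" "y \<noteq> i" and deg: "card {e \<in> LG. Some y \<in> e} \<le> 1"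
  shows "Transposition.transpose None (Some (j, y)) \<in> P"
proof -
  let ?s = "map_permutation BN (copy y) \<phi>" and ?D = "{e \<in> LG. Some y \<in> e}"
  have s: "?s (copy y p) = copy y (\<phi> p)" if "p \<in> BN" for p
    using that by (rule copy_permutation_copy)
  have "?s \<in> near_automorphisms Y K"
  proof (rule near_automorphismsI)
    show "?s permutes Y"
      by (rule map_permutation_permutes_superset[OF inj_on_copy copy_BN[OF y(1)] \<phi>(1)])
    show "(`) ?s ` K - K \<subseteq> (`) (\<lambda>p. ?s (base p)) ` ?D"
    proof
      fix e
      assume "e \<in> (`) ?s ` K - K"
      then obtain e' where e': "e' \<in> K" "e = ?s ` e'" and eK: "e \<notin> K" by auto
      from e'(1) consider (base) d where "d \<in> LG" "e' = base ` d"
        | (copy) x d where "x \<in> X" "d \<in> LH" "e' = copy x ` d"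
        unfolding K_def by auto
      then show "e \<in> (`) (\<lambda>p. ?s (base p)) ` ?D"
      proof cases
        case base
        have "Some y \<in> d"
        proof (rule ccontr)
          assume "Some y \<notin> d"
          have "?s p = p" if p: "p \<in> base ` d" for p
          proof -
            obtain q where q: "q \<in> d" "p = base q"
              using p by blast
            then obtain x where "q = Some x"
              using base(1) LG by blast
            with q have "Some x \<in> d" "p = Some (j, x)"
              by simp_all
            with \<open>Some y \<notin> d\<close> show ?thesis
              using copy_permutation_other[of x y] by metis
          qed
          then have "e = e'"
            using e'(2) base(2) by simp
          with e' eK show False by simp
        qed
        with base e'(2) show ?thesis
          by (auto simp: image_image)
      next
        case copy
        have "e \<in> K"
        proof (cases "x = y")
          case True
          have "d \<subseteq> BN"
            using copy(2) LH_Pow by blast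
          then have "e = copy y ` \<phi> ` d"
            unfolding e'(2) copy(3) True by (rule map_permutation_image[OF inj_on_copy])
          moreover have "\<phi> ` d \<in> LH"
            using \<phi>(2) copy(2) by blast
          ultimately show ?thesis
            using y(1) unfolding K_def by blast
        next
          case False
          then show ?thesis
            using copy_permutation_copy_other[OF False copy(2)] copy(3) e' by simp
        qed
        with eK show ?thesis ..
      qed
    qed
    show "finite ((`) (\<lambda>p. ?s (base p)) ` ?D)"
      using finite_LG by simp
    show "card ((`) (\<lambda>p. ?s (base p)) ` ?D) \<le> 1"
      using card_image_le[of ?D "(`) (\<lambda>p. ?s (base p))"] finite_LG deg by simp
  qed
  then have sP: "?s \<in> P"
    using y(2) copy_permutation_other[of i y] by (intro P_incl) auto
  have T: "Transposition.transpose None (copy y p) \<in> P" if "p \<in> BN" "p \<noteq> Some j" for p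
    using H y(1) that by (rule transpose_copy_mem_P)
  have inj: "inj \<phi>"
    using \<phi>(1) by (rule permutes_inj)
  obtain q where q: "\<phi> q = Some j" "q \<in> BN"
    using permutes_inverses(1)[OF \<phi>(1), of "Some j"] permutes_in_image[OF \<phi>(1)] j by blast
  obtain b where b: "b \<in> B" "b \<noteq> j"
    using B j by blast
  \<comment> \<open>The point \<open>p\<close> is wanted off the root and with image off the root.
    \<open>None\<close> qualifies unless \<open>\<phi>\<close> sends it to the root; then
    injectivity makes the second label \<open>b\<close> qualify.\<close>
  obtain p where p: "p \<in> BN" "p \<noteq> Some j" "\<phi> p \<noteq> Some j"
  proof (cases "\<phi> None = Some j")
    case True
    then have "\<phi> (Some b) \<noteq> Some j"
      using injD[OF inj, of None "Some b"] by auto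
    with b that show ?thesis by auto
  next
    case False
    with that show ?thesis by auto
  qed
  \<comment> \<open>Both points are off the root and already reached; conjugation by
    \<open>?s\<close> turns \<open>q\<close> into the root of the copy and \<open>p\<close> into
    another reached point.\<close>
  have "Transposition.transpose (copy y p) (copy y q) \<in> P"
    using T[OF p(1,2)] T[OF q(2)] q \<phi>(3) transpose_trans_mem[OF subgroup_P, of "copy y p" None "copy y q"]
    by (auto simp: transpose_commute)
  from transpose_conj_mem[OF subgroup_P sP this]
  have "Transposition.transpose (copy y (\<phi> p)) (Some (j, y)) \<in> P"
    using s[OF p(1)] s[OF q(2)] q(1) by simp
  moreover have "Transposition.transpose None (copy y (\<phi> p)) \<in> P"
    using T[of "\<phi> p"] p permutes_in_image[OF \<phi>(1)] by auto
  ultimately show ?thesis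
    using transpose_trans_mem[OF subgroup_P] by blast
qed

text \<open>As \<open>\<tau>\<close> fixes \<open>None\<close>, it permutes whole copies of the
  second factor. Copies go to copies, so new edges can arise only from base edges, where they
  correspond to new edges of \<open>\<tau>\<close>.\<close>

lemma lift_mem_P:
  assumes \<tau>: "\<tau> \<in> stem_set XN LG (Some i)" "\<tau> None = None"
  obtains g where "g \<in> P" and "g None = None" and "\<And>x. g (Some (j, x)) = base (\<tau> (Some x))"
proof -
  \<comment> \<open>Pairs whose first entry lies outside \<open>B\<close> must stay fixed, because a
    permutation of \<open>Y\<close> has to be the identity off \<open>Y\<close>.\<close>
  let ?g = "\<lambda>p. case p of None \<Rightarrow> None
    | Some (b, x) \<Rightarrow> if b \<in> B then map_option (Pair b) (\<tau> (Some x)) else p"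
  have \<tau>': "\<tau> permutes XN" "card ((`) \<tau> ` LG - LG) \<le> 1" "\<tau> (Some i) = Some i"
    using \<tau>(1) by (simp_all add: stem_set_def near_automorphisms_def)
  have ex: "\<exists>x'. \<tau> (Some x) = Some x'" for x
    using injD[OF permutes_inj[OF \<tau>'(1)], of None "Some x"] \<tau>(2) by (cases "\<tau> (Some x)") auto
  have exX: "\<exists>x'\<in>X. \<tau> (Some x) = Some x'" if "x \<in> X" for x
    using ex[of x] permutes_in_image[OF \<tau>'(1), of "Some x"] that by auto
  have none: "?g None = None" by simp
  have g_base: "?g (Some (j, x)) = base (\<tau> (Some x))" for x
    using j by (simp add: base_def)
  have gY: "?g ` Y \<subseteq> Y"
    using exX by (force simp: Y_def)
  have "inj_on ?g Y"
  proof (rule inj_onI)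
    fix p q
    assume "p \<in> Y" "q \<in> Y" and eq: "?g p = ?g q"
    show "p = q"
    proof (cases p; cases q)
      fix pp qq assume pq: "p = Some pp" "q = Some qq"
      obtain b x b' x' where bx: "pp = (b, x)" "qq = (b', x')" by (cases pp; cases qq)
      obtain z z' where "\<tau> (Some x) = Some z" "\<tau> (Some x') = Some z'"
        using ex by blast
      moreover have "b \<in> B" "b' \<in> B"
        using \<open>p \<in> Y\<close> \<open>q \<in> Y\<close> pq bx by (auto simp: Y_def)
      ultimately have "b = b'" "\<tau> (Some x) = \<tau> (Some x')"
        using eq pq bx by simp_all
      then show "p = q"
        using pq bx injD[OF permutes_inj[OF \<tau>'(1)]] by blast
    next
      fix qq assume "p = None" "q = Some qq"
      then show "p = q"
        using eq ex[of "snd qq"] \<open>q \<in> Y\<close> by (auto simp: Y_def)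
    next
      fix pp assume "p = Some pp" "q = None"
      then show "p = q"
        using eq ex[of "snd pp"] \<open>p \<in> Y\<close> by (auto simp: Y_def)
    qed simp
  qed
  moreover have "finite Y"
    using finite_X finite_B by (simp add: Y_def)
  ultimately have "bij_betw ?g Y Y"
    using gY endo_inj_surj[of Y ?g] by (simp add: bij_betw_def)
  moreover have "?g p = p" if "p \<notin> Y" for p
  proof (cases p)
    case (Some pp)
    obtain b x where bx: "pp = (b, x)" by (cases pp)
    have "\<tau> (Some x) = Some x" if "b \<in> B"
      using \<open>p \<notin> Y\<close> Some bx that by (intro permutes_not_in[OF \<tau>'(1)]) (auto simp: Y_def)
    with Some bx show ?thesis by simp
  qed simp
  ultimately have perm: "?g permutes Y"
    by (rule bij_imp_permutes)
  have "?g \<in> P"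
  proof (rule P_incl)
    show "?g (Some (j, i)) = Some (j, i)"
      unfolding g_base by (simp add: \<tau>'(3))
    let ?D = "(`) \<tau> ` LG - LG"
    have fin: "finite ?D"
      using finite_LG by simp
    show "?g \<in> near_automorphisms Y K"
    proof (rule near_automorphismsI[OF perm])
      show "(`) ?g ` K - K \<subseteq> (`) base ` ?D"
      proof
        fix e
        assume "e \<in> (`) ?g ` K - K"
        then obtain e' where e': "e' \<in> K" "e = ?g ` e'" and eK: "e \<notin> K" by blast
        from e'(1) consider (base) d where "d \<in> LG" "e' = base ` d"
          | (copy) x d where "x \<in> X" "d \<in> LH" "e' = copy x ` d"
          unfolding K_def by auto
        then show "e \<in> (`) base ` ?D"
        proof cases
          case base
          have "?g (base p) = base (\<tau> p)" for p
            using \<tau>(2) by (cases p) (simp_all add: j base_def)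
          then have e: "e = base ` \<tau> ` d"
            unfolding e'(2) base(2) image_image by simp
          then have "\<tau> ` d \<notin> LG"
            using eK unfolding K_def by blast
          with base(1) e show ?thesis by blast
        next
          case copy
          obtain x' where x': "x' \<in> X" "\<tau> (Some x) = Some x'"
            using exX[OF copy(1)] by blast
          have "?g (copy x p) = copy x' p" if p: "p \<in> d" for p
          proof -
            obtain b where "b \<in> B" "p = Some b"
              using p copy(2) LH by blast
            with x'(2) show ?thesis by simp
          qed
          then have "e = copy x' ` d"
            unfolding e'(2) copy(3) image_image by (intro image_cong) simp_all
          then have "e \<in> K"
            using x'(1) copy(2) unfolding K_def by blast
          with eK show ?thesis ..
        qed
      qed
      show "finite ((`) base ` ?D)"
        using fin by simp
      show "card ((`) base ` ?D) \<le> 1"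
        using card_image_le[OF fin, of "(`) base"] \<tau>'(2) by simp
    qed
  qed
  from that[OF this none g_base] show thesis .
qed

text \<open>The reached labels together with \<open>None\<close> form a set \<open>S\<close>
  preserved by all generators for the first factor. These generate the transposition of
  \<open>None\<close> and \<open>Some x\<close>, which moves \<open>None\<close> to
  \<open>Some x\<close> and hence puts the latter in \<open>S\<close>.\<close>

lemma transpose_base_mem_P:
  assumes G: "generate (Sym XN) (stem_set XN LG (Some i)) = {\<sigma>. \<sigma> permutes (XN - {Some i})}"
    and H: "generate (Sym BN) (stem_set BN LH (Some j)) = {\<sigma>. \<sigma> permutes (BN - {Some j})}"
    and \<phi>: "\<phi> permutes BN" "(`) \<phi> ` LH = LH" "\<phi> (Some j) \<noteq> Some j"
    and B: "B \<noteq> {j}" and x: "x \<in> X" "x \<noteq> i"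
  shows "Transposition.transpose None (Some (j, x)) \<in> P"
proof -
  define S where "S = {p \<in> XN - {Some i}. Transposition.transpose None (base p) \<in> P}"
  have S_None: "None \<in> S"
    using Sym_subgroupD(2)[OF subgroup_P] by (simp add: S_def)
  have "finite S"
    unfolding S_def using finite_X by simp
  have LG': "LG \<subseteq> Pow (XN - {None})"
    using LG by auto
  have gen: "\<sigma> permutes XN \<and> \<sigma> ` S = S" if \<sigma>: "\<sigma> \<in> stem_set XN LG (Some i)" for \<sigma>
  proof -
    have \<sigma>': "\<sigma> \<in> near_automorphisms XN LG" "\<sigma> permutes XN" "\<sigma> (Some i) = Some i"
      using \<sigma> by (simp_all add: stem_set_def near_automorphisms_def)
    have inj: "inj \<sigma>"
      using \<sigma>'(2) by (rule permutes_inj)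
    \<comment> \<open>The correction fixes \<open>None\<close>, so it can be lifted, and it agrees
      with \<open>\<sigma>\<close> except at \<open>None\<close> and the preimage of
      \<open>None\<close>.\<close>
    let ?\<tau> = "Transposition.transpose (\<sigma> None) None \<circ> \<sigma>"
    have ne: "\<sigma> None \<noteq> Some i"
      using injD[OF inj, of None "Some i"] \<sigma>'(3) by auto
    have \<tau>: "?\<tau> \<in> stem_set XN LG (Some i)" "?\<tau> None = None"
      using near_automorphisms_fix_isolated[OF \<sigma>'(1) insertI1 finite_LG LG'] \<sigma>'(3) ne
      by (simp_all add: stem_set_def)
    obtain g where g: "g \<in> P" "g None = None" "\<And>x. g (Some (j, x)) = base (?\<tau> (Some x))"
      using lift_mem_P[OF \<tau>] by blast
    have "\<sigma> p \<in> S" if p: "p \<in> S" for p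
    proof -
      have pX: "p \<in> XN" "p \<noteq> Some i"
        using p by (auto simp: S_def)
      then have \<sigma>p: "\<sigma> p \<in> XN" "\<sigma> p \<noteq> Some i"
        using permutes_in_image[OF \<sigma>'(2), of p] injD[OF inj, of p "Some i"] \<sigma>'(3) by auto
      have "Transposition.transpose None (base (\<sigma> p)) \<in> P"
      proof (cases "\<sigma> p")
        case None
        with S_None show ?thesis by (simp add: S_def)
      next
        case (Some y)
        show ?thesis
        proof (cases p)
          case None
          \<comment> \<open>Here \<open>y\<close> comes from the image of the isolated label, hence
            has degree at most one, and the root-moving automorphism applies.\<close>
          then have "card {e \<in> LG. Some y \<in> e} \<le> 1"
            using near_automorphisms_degree_le_1[OF \<sigma>'(1) finite_LG LG'] Some by simp
          then have "Transposition.transpose None (Some (j, y)) \<in> P"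
            using \<sigma>p Some by (intro transpose_root_copy_mem_P[OF H \<phi> B]) auto
          with Some show ?thesis by simp
        next
          case px: (Some z)
          \<comment> \<open>As \<open>\<sigma> p\<close> is neither \<open>None\<close> nor
            \<open>\<sigma> None\<close>, the lift carries the label of \<open>p\<close> to that of
            \<open>\<sigma> p\<close>, and conjugation passes membership on.\<close>
          have "\<sigma> p \<noteq> \<sigma> None"
            using px injD[OF inj, of p None] by auto
          then have "g (Some (j, z)) = base (\<sigma> p)"
            using g(3)[of z] px Some by simp
          moreover have "Transposition.transpose None (Some (j, z)) \<in> P"
            using p px by (simp add: S_def)
          ultimately show ?thesis
            using transpose_conj_mem[OF subgroup_P g(1), of None "Some (j, z)"] g(2) by simp
        qed
      qed
      with \<sigma>p show ?thesis by (simp add: S_def)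
    qed
    \<comment> \<open>Finiteness turns the inclusion into an equality, which is stable under
      inverses.\<close>
    then have "\<sigma> ` S \<subseteq> S" by blast
    with \<open>finite S\<close> have "\<sigma> ` S = S"
      using inj by (intro endo_inj_surj inj_on_subset[of \<sigma> UNIV S]) auto
    with \<sigma>'(2) show ?thesis by blast
  qed
  have "subgroup {\<sigma>. \<sigma> permutes XN \<and> \<sigma> ` S = S} (Sym XN)"
  proof (rule Sym_subgroupI)
    fix \<sigma> assume \<sigma>: "\<sigma> \<in> {\<sigma>. \<sigma> permutes XN \<and> \<sigma> ` S = S}"
    then have perm: "\<sigma> permutes XN" and S: "\<sigma> ` S = S"
      by simp_all
    have "inv' \<sigma> ` \<sigma> ` S = S"
      unfolding image_image permutes_inverses[OF perm] by simp
    then have "inv' \<sigma> ` S = S"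
      unfolding S .
    with \<sigma> show "inv' \<sigma> \<in> {\<sigma>. \<sigma> permutes XN \<and> \<sigma> ` S = S}"
      by (simp add: permutes_inv)
  next
    fix \<sigma> \<tau> :: "'x option \<Rightarrow> 'x option"
    assume "\<sigma> \<in> {\<sigma>. \<sigma> permutes XN \<and> \<sigma> ` S = S}" "\<tau> \<in> {\<sigma>. \<sigma> permutes XN \<and> \<sigma> ` S = S}"
    then show "\<sigma> \<circ> \<tau> \<in> {\<sigma>. \<sigma> permutes XN \<and> \<sigma> ` S = S}"
      by (auto simp only: mem_Collect_eq permutes_compose image_comp[symmetric])
  qed (simp_all add: permutes_id)
  then have "generate (Sym XN) (stem_set XN LG (Some i)) \<subseteq> {\<sigma>. \<sigma> permutes XN \<and> \<sigma> ` S = S}"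
    using gen by (intro group.generate_subgroup_incl[OF group_Sym]) auto
  moreover have "Transposition.transpose None (Some x) \<in> generate (Sym XN) (stem_set XN LG (Some i))"
    unfolding G using x by (simp add: permutes_swap_id)
  ultimately have "Transposition.transpose None (Some x) ` S = S"
    by blast
  with S_None have "Some x \<in> S"
    by (metis imageI transpose_apply_first)
  then show ?thesis
    by (simp add: S_def)
qed

text \<open>With \<open>B = {j}\<close> there is no second label for the copy argument. Edges have
  two labels, so \<open>LH\<close> is empty, \<open>K\<close> is the image of \<open>LG\<close>
  under \<open>base\<close>, and the generators of the first factor transport directly.\<close>

lemma transpose_base_mem_P_singleton:
  assumes G: "generate (Sym XN) (stem_set XN LG (Some i)) = {\<sigma>. \<sigma> permutes (XN - {Some i})}"
    and B: "B = {j}" and x: "x \<in> X" "x \<noteq> i"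
  shows "Transposition.transpose None (Some (j, x)) \<in> P"
proof -
  have "LH = {}"
  proof (rule ccontr)
    assume "LH \<noteq> {}"
    then obtain e where "e \<in> LH" by blast
    then have "e \<subseteq> {Some j}" "card e = 2"
      using LH B card_LH by auto
    then show False
      using card_mono[of "{Some j}" e] by simp
  qed
  then have K: "K = (`) base ` LG \<union> {}"
    unfolding K_def by simp
  have "map_permutation XN base \<sigma> \<in> P" if "\<sigma> \<in> stem_set XN LG (Some i)" for \<sigma>
  proof (rule P_incl)
    have \<sigma>: "\<sigma> \<in> near_automorphisms XN LG" "\<sigma> (Some i) = Some i"
      using that by (simp_all add: stem_set_def)
    show "map_permutation XN base \<sigma> \<in> near_automorphisms Y K"
      unfolding K by (rule near_automorphisms_map_permutation[OF inj_on_base base_XN \<sigma>(1) LG_Pow finite_XN]) simp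
    show "map_permutation XN base \<sigma> (Some (j, i)) = Some (j, i)"
      using map_permutation_apply[OF inj_on_base, of "Some i" XN \<sigma>] i \<sigma>(2) by simp
  qed
  moreover have "Transposition.transpose None (Some x) \<in> generate (Sym XN) (stem_set XN LG (Some i))"
    unfolding G using x by (simp add: permutes_swap_id)
  ultimately have "map_permutation XN base (Transposition.transpose None (Some x)) \<in> P"
    using stem_set_subset[of XN LG "Some i"]
    by (intro map_permutation_generate_mem[OF inj_on_base subgroup_P])
      (auto simp: permutes_Diff_singleton_iff)
  then show ?thesis
    using x(1) by (simp add: map_permutation_transpose[OF inj_on_base])
qed

text \<open>The transpositions through \<open>None\<close> suffice: labels with first entry
  different from \<open>j\<close> are reached inside copies, the remaining ones through the first
  factor.\<close>

lemma P_eq_stabilizer: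
  assumes G: "generate (Sym XN) (stem_set XN LG (Some i)) = {\<sigma>. \<sigma> permutes (XN - {Some i})}"
    and H: "generate (Sym BN) (stem_set BN LH (Some j)) = {\<sigma>. \<sigma> permutes (BN - {Some j})}"
    and \<phi>: "\<phi> permutes BN" "(`) \<phi> ` LH = LH" "\<phi> (Some j) \<noteq> Some j"
  shows "P = {\<sigma>. \<sigma> permutes (Y - {Some (j, i)})}"
proof
  show "P \<subseteq> {\<sigma>. \<sigma> permutes (Y - {Some (j, i)})}"
    unfolding P_def
    by (rule group.generate_subgroup_incl[OF group_Sym stem_set_subset subgroup_Sym_stabilizer])
  have "Transposition.transpose None p \<in> P" if p: "p \<in> Y - {Some (j, i)}" for p
  proof (cases p)
    case None
    then show ?thesis
      using Sym_subgroupD(2)[OF subgroup_P] by simp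
  next
    case (Some bx)
    obtain b x where bx: "bx = (b, x)" by (cases bx)
    have mem: "b \<in> B" "x \<in> X" "b = j \<Longrightarrow> x \<noteq> i"
      using p Some bx by (auto simp: Y_def)
    show ?thesis
    proof (cases "b = j")
      case True
      then show ?thesis
        using transpose_base_mem_P[OF G H \<phi>, of x] transpose_base_mem_P_singleton[OF G, of x] mem Some bx
        by auto
    next
      case False
      then show ?thesis
        using transpose_copy_mem_P[OF H mem(2), of "Some b"] mem Some bx by simp
    qed
  qed
  moreover have "finite (Y - {Some (j, i)})"
    using finite_X finite_B by (simp add: Y_def)
  ultimately show "{\<sigma>. \<sigma> permutes (Y - {Some (j, i)})} \<subseteq> P"
    using permutes_mem_if_transposes_mem[OF subgroup_P] by blast
qed

end

theorem theorem5:
  fixes G :: "('v, 'x) lgraph" and H :: "('w, 'b) lgraph" and i :: 'x and j :: 'b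
  assumes "rooted_labeled_graph G i"
    and "rooted_labeled_graph H j"
    and "stem_symmetric (add_isolated G) (Some i)"
    and "stem_symmetric (add_isolated H) (Some j)"
    and "\<exists>w. root_similar_vertex (add_isolated H) (Some j) w"
  shows "stem_symmetric (add_isolated (comb_product G H j)) (Some (j, i))"
proof -
  have G: "labeled_graph G" "i \<in> labels G" and H: "labeled_graph H" "j \<in> labels H"
    using assms(1,2) by (simp_all add: rooted_labeled_graph_def)
  have G': "labeled_graph (add_isolated G)" and H': "labeled_graph (add_isolated H)"
    using G(1) H(1) by (simp_all add: labeled_graph_add_isolated)
  have C: "labeled_graph (comb_product G H j)"
    using G(1) assms(2) by (rule labeled_graph_comb_product)
  have C': "labeled_graph (add_isolated (comb_product G H j))"
    using C by (rule labeled_graph_add_isolated)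
  have labels: "labels (add_isolated K) = insert None (Some ` labels K)" for K :: "('c, 'd) lgraph"
    by (simp add: add_isolated_def)
  interpret comb_labels "labels G" "labels H" i j "(`) Some ` label_edges G" "(`) Some ` label_edges H"
  proof
    show "(`) Some ` label_edges G \<subseteq> Pow (Some ` labels G)" "(`) Some ` label_edges H \<subseteq> Pow (Some ` labels H)"
      using label_edges_subset_Pow[of G] label_edges_subset_Pow[of H] by blast+
    show "card e = 2" if "e \<in> (`) Some ` label_edges H" for e
      using that card_label_edge[OF H(1)] by (auto simp: card_image)
  qed (use G H labeled_graphD(1) in auto)
  have genG: "generate (Sym (insert None (Some ` labels G)))
      (stem_set (insert None (Some ` labels G)) ((`) Some ` label_edges G) (Some i)) =
    {\<sigma>. \<sigma> permutes (insert None (Some ` labels G) - {Some i})}"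
    using assms(3) stem_symmetric_iff[OF G', of "Some i"] G(2)
    by (simp add: labels label_edges_add_isolated[OF G(1)])
  have genH: "generate (Sym (insert None (Some ` labels H)))
      (stem_set (insert None (Some ` labels H)) ((`) Some ` label_edges H) (Some j)) =
    {\<sigma>. \<sigma> permutes (insert None (Some ` labels H) - {Some j})}"
    using assms(4) stem_symmetric_iff[OF H', of "Some j"] H(2)
    by (simp add: labels label_edges_add_isolated[OF H(1)])
  \<comment> \<open>A root-similar vertex has a label other than the root, so its automorphism moves
    the root.\<close>
  obtain \<phi> where "\<phi> \<in> Aut (add_isolated H)" "\<phi> (Some j) \<noteq> Some j"
    using assms(5) unfolding root_similar_vertex_def by metis
  then have \<phi>: "\<phi> permutes insert None (Some ` labels H)"
    "(`) \<phi> ` (`) Some ` label_edges H = (`) Some ` label_edges H" "\<phi> (Some j) \<noteq> Some j"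
    unfolding Aut_iff_image[OF H'] labels label_edges_add_isolated[OF H(1)] by blast+
  have Y: "labels (add_isolated (comb_product G H j)) = Y"
    by (simp add: labels Y_def comb_product_def)
  have "label_edges (add_isolated (comb_product G H j)) = K"
    unfolding label_edges_add_isolated[OF C] label_edges_comb_product[OF G(1) assms(2)] K_def
      image_Un image_UN image_comp comp_def base_def copy_def
    by simp
  then show ?thesis
    using P_eq_stabilizer[OF genG genH \<phi>] stem_symmetric_iff[OF C', of "Some (j, i)"] G(2) H(2)
    unfolding Y P_def by (simp add: Y_def)
qed

end
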